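(* Let $q\geq 3$ be a prime power, $s\geq 2$, $n=\frac{q^{2s}-1}{q+1}$, and $2\le\delta\le n$. Let $\delta_{1,n}$ be the largest $q$-cyclotomic coset leader modulo $n$. (1) If $s=2$, then $\mathcal{C}_{(q,n,\delta,2)}$ is a dually-BCH code if and only if $\delta_{1,n}-1\leq\delta\leq n-1$. (2) If $s\neq 2$, then $\mathcal{C}_{(q,n,\delta,2)}$ is a dually-BCH code if and only if $\delta_{1,n}\leq\delta\leq n-1$.
   Context: Let $\alpha$ be a generator of $\mathbb{F}_{q^{2s}}^*$ and $\beta_1=\alpha^{q+1}$, a primitive $n$-th root of unity. For an integer $j$ (read modulo $n$) let $m_j(x)$ be the minimal polynomial of $\beta_1^j$ over $\mathbb{F}_q$. For integers $b\ge 1$ and $2\le\delta\le n$, the BCH code $\mathcal{C}_{(q,n,\delta,b)}$ with respect to $\beta_1$ is the cyclic code of length $n$ over $\mathbb{F}_q$ (an ideal of $\mathbb{F}_q[x]/\langle x^n-1\rangle$) generated by $\mathrm{lcm}(m_b(x),m_{b+1}(x),\dots,m_{b+\delta-2}(x))$. A BCH code is called dually-BCH if its dual code (with respect to the standard inner product) is again a BCH code $\mathcal{C}_{(q,n,\delta',b')}$ with respect to the same primitive $n$-th root of unity, for some $b'$ and $\delta'$. The $q$-cyclotomic coset of $t$ modulo $n$ is $C_t=\{tq^j\bmod n: j\ge 0\}$; its smallest element is its coset leader. It is known that $\delta_{1,n}=\frac{(q-1)q^{2s-1}-q^{s-1}-1}{q+1}$ if $2\nmid s$ and $\delta_{1,n}=\frac{(q-1)q^{2s-1}-q^{s}-1}{q+1}$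 if $2\mid s$. *)

theory Defs
  imports
    "HOL-Computational_Algebra.Computational_Algebra"
    "HOL-Number_Theory.Prime_Powers"
    "Jordan_Normal_Form.Matrix"
begin

text \<open>
  The base field is a type \<open>'a\<close>, the extension field a type \<open>'b\<close>, and \<open>h\<close> is the
  inclusion of the former into the latter (a field homomorphism).

  The sort \<open>field_gcd\<close> on \<open>'a\<close> only serves to make the library's \<open>Lcm\<close> available on
  \<open>'a poly\<close>. It adds the canonical (trivial) Euclidean operations of a field and puts no
  restriction on the field itself; with it, \<open>Lcm\<close> of a finite set of nonzero polynomials
  is monic.
\<close>

definition min_poly :: "('a::field \<Rightarrow> 'b::field) \<Rightarrow> 'b \<Rightarrow> 'a poly" where
  "min_poly h x = (THE p. lead_coeff p = 1 \<and> poly (map_poly h p) x = 0 \<and>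
     (\<forall>p'. p' \<noteq> 0 \<and> poly (map_poly h p') x = 0 \<longrightarrow> degree p \<le> degree p'))"

text \<open>
  The ideal generated by \<open>g\<close> in the quotient of \<open>'a poly\<close> by \<open>x\<^sup>n - 1\<close>: a residue class is
  represented by its remainder modulo \<open>x\<^sup>n - 1\<close>, which is identified with its coefficient
  vector of length \<open>n\<close>.
\<close>

definition cyclic_code :: "nat \<Rightarrow> 'a::field poly \<Rightarrow> 'a vec set" where
  "cyclic_code n g = {vec n (coeff ((f * g) mod (monom 1 n - 1))) |f. True}"

definition dual_code :: "nat \<Rightarrow> 'a::field vec set \<Rightarrow> 'a vec set" where
  "dual_code n C = {x \<in> carrier_vec n. \<forall>c\<in>C. x \<bullet> c = 0}"

definition bch_code ::
    "('a::field_gcd \<Rightarrow> 'b::field) \<Rightarrow> 'b \<Rightarrow> nat \<Rightarrow> nat \<Rightarrow> nat \<Rightarrow> 'a vec set" where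
  "bch_code h \<beta> n \<delta> b = cyclic_code n (Lcm ((\<lambda>j. min_poly h (\<beta> ^ j)) ` {b..b + \<delta> - 2}))"

definition is_bch_code ::
    "('a::field_gcd \<Rightarrow> 'b::field) \<Rightarrow> 'b \<Rightarrow> nat \<Rightarrow> 'a vec set \<Rightarrow> bool" where
  "is_bch_code h \<beta> n C \<longleftrightarrow> (\<exists>b \<delta>. 1 \<le> b \<and> 2 \<le> \<delta> \<and> \<delta> \<le> n \<and> C = bch_code h \<beta> n \<delta> b)"

definition dually_bch ::
    "('a::field_gcd \<Rightarrow> 'b::field) \<Rightarrow> 'b \<Rightarrow> nat \<Rightarrow> 'a vec set \<Rightarrow> bool" where
  "dually_bch h \<beta> n C \<longleftrightarrow> is_bch_code h \<beta> n C \<and> is_bch_code h \<beta> n (dual_code n C)"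

definition cyclotomic_coset :: "nat \<Rightarrow> nat \<Rightarrow> nat \<Rightarrow> nat set" where
  "cyclotomic_coset q n t = {(t * q ^ j) mod n |j. True}"

definition coset_leaders :: "nat \<Rightarrow> nat \<Rightarrow> nat set" where
  "coset_leaders q n = {Min (cyclotomic_coset q n t) |t. t < n}"

definition largest_coset_leader :: "nat \<Rightarrow> nat \<Rightarrow> nat" where
  "largest_coset_leader q n = Max (coset_leaders q n)"

end

theory Submission
  imports Defs "HOL-Number_Theory.Cong" "Jordan_Normal_Form.Char_Poly"
begin

text \<open>
  By the discrete Fourier transform, a cyclic code is determined by the union \<open>T\<close> of the cyclotomic
  cosets of its zeros, and its dual has the zeros \<open>{i. -i \<notin> T}\<close>: Parseval's identity gives
  one inclusion, and codewords of the form \<open>tr (u * \<beta>\<^sup>i\<^sup>m)\<close>, together with the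
  nondegeneracy of the trace, give the other. It remains to decide when the complement of \<open>-T\<close> is
  the union of the cosets of an interval, where \<open>T\<close> is the union of the cosets of
  \<open>2, \<dots>, \<delta>\<close>. Such an interval contains \<open>0\<close> modulo \<open>n\<close>, and its length is
  restricted on the left by the \<open>-j\<close> with \<open>2 \<le> j \<le> \<delta>\<close>. With \<open>N = n / (q - 1)\<close>, which
  forms a coset by itself, one finds that \<open>n - N \<le> \<delta>\<close> and that the interval lies in
  \<open>{0..q - 2}\<close>. For \<open>s = 2\<close> the number \<open>n - N\<close> is \<open>\<delta>\<^sub>1 - 1\<close>. For \<open>s \<ge> 3\<close> the
  coset of \<open>q\<^sup>2 - q + 1\<close> shows that \<open>\<delta>\<^sub>1\<close> exceeds \<open>n - q\<^sup>2\<^sup>s\<^sup>-\<^sup>2\<close>, hence every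
  leader of the coset of some \<open>-j\<close> with \<open>1 \<le> j \<le> q - 2\<close>, and so \<open>\<delta>\<^sub>1 \<le> \<delta>\<close>.
\<close>

subsection \<open>Cyclotomic cosets\<close>

text \<open>Integers replace residues below \<open>n\<close>, so that negated and shifted indices
  need no reduction. Symmetry holds once q is known to be a unit modulo n
  (\<open>sim_sym\<close>).\<close>

definition coset_sim :: "nat \<Rightarrow> nat \<Rightarrow> int \<Rightarrow> int \<Rightarrow> bool" where
  "coset_sim q n x y \<longleftrightarrow> (\<exists>k. [y = x * int q ^ k] (mod int n))"

definition in_cosets :: "nat \<Rightarrow> nat \<Rightarrow> nat set \<Rightarrow> int \<Rightarrow> bool" where
  "in_cosets q n J i \<longleftrightarrow> (\<exists>j\<in>J. coset_sim q n (int j) i)"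

lemma coset_sim_refl: "coset_sim q n x x"
  unfolding coset_sim_def by (rule exI[of _ 0]) simp

lemma coset_sim_trans: "coset_sim q n x y \<Longrightarrow> coset_sim q n y z \<Longrightarrow> coset_sim q n x z"
  unfolding coset_sim_def
proof (elim exE)
  fix k l
  assume "[y = x * int q ^ k] (mod int n)" "[z = y * int q ^ l] (mod int n)"
  hence "[z = x * int q ^ k * int q ^ l] (mod int n)"
    using cong_scalar_right cong_trans by blast
  thus "\<exists>k. [z = x * int q ^ k] (mod int n)"
    by (intro exI[of _ "k + l"]) (simp add: power_add mult.assoc)
qed

lemma coset_sim_uminus: "coset_sim q n x y \<Longrightarrow> coset_sim q n (-x) (-y)"
  unfolding coset_sim_def by (auto simp: cong_minus_minus_iff)

lemma coset_sim_uminus_iff: "coset_sim q n (-x) y \<longleftrightarrow> coset_sim q n x (-y)"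
  using coset_sim_uminus[of q n x "-y"] coset_sim_uminus[of q n "-x" y] by auto

lemma coset_sim_cong:
  assumes "[x = x'] (mod int n)" "[y = y'] (mod int n)"
  shows "coset_sim q n x y \<longleftrightarrow> coset_sim q n x' y'"
  unfolding coset_sim_def
  by (metis assms cong_scalar_right cong_sym cong_trans)

lemma coset_sim_powerI: "[y = x * int q ^ k] (mod int n) \<Longrightarrow> coset_sim q n x y"
  unfolding coset_sim_def by blast

lemma in_cosets_sim: "in_cosets q n J x \<Longrightarrow> coset_sim q n x y \<Longrightarrow> in_cosets q n J y"
  unfolding in_cosets_def using coset_sim_trans by blast

lemma in_cosetsI: "0 \<le> x \<Longrightarrow> nat x \<in> J \<Longrightarrow> in_cosets q n J x"
  unfolding in_cosets_def using coset_sim_refl by (metis nat_0_le)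

lemma cyclotomic_coset_iff:
  assumes "0 < n"
  shows "u \<in> cyclotomic_coset q n t \<longleftrightarrow> u < n \<and> coset_sim q n (int t) (int u)"
proof
  assume "u \<in> cyclotomic_coset q n t"
  then obtain j where "u = (t * q ^ j) mod n"
    unfolding cyclotomic_coset_def by auto
  thus "u < n \<and> coset_sim q n (int t) (int u)"
    using assms unfolding coset_sim_def
    by (auto simp: zmod_int intro!: exI[of _ j])
next
  assume u: "u < n \<and> coset_sim q n (int t) (int u)"
  then obtain k where "[int u = int (t * q ^ k)] (mod int n)"
    unfolding coset_sim_def by auto
  hence "u mod n = (t * q ^ k) mod n"
    by (simp only: cong_int_iff) (simp add: cong_def)
  thus "u \<in> cyclotomic_coset q n t"
    using u unfolding cyclotomic_coset_def by auto
qed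

section \<open>Arithmetic of n, N and E\<close>

locale bch_params =
  fixes q s n :: nat
  assumes q_ge: "3 \<le> q" and s_ge: "2 \<le> s"
    and n_eq: "(q + 1) * n = q ^ (2 * s) - 1"
begin

abbreviation sim (infix "\<sim>" 50) where "x \<sim> y \<equiv> coset_sim q n x y"

text \<open>Multiplication by \<open>q\<close> modulo \<open>n\<close> fixes \<open>N\<close>, so the cosets of the multiples of \<open>N\<close> are
  singletons, and \<open>E\<close> is inverse to \<open>q\<^sup>2\<close>, so \<open>c * E\<close> lies in the coset of \<open>c\<close>.\<close>

definition N :: int where "N = int n div (int q - 1)"
definition E :: int where "E = int q ^ (2 * s - 2)"

lemma E_ge: "int q ^ 2 \<le> E"
  unfolding E_def using q_ge s_ge by (intro power_increasing) auto

lemma q2_ge: "9 \<le> int q ^ 2"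
proof -
  have "(3::int) ^ 2 \<le> int q ^ 2" using q_ge by (intro power_mono) auto
  thus ?thesis by simp
qed

lemma q_le_q2: "3 * int q \<le> int q ^ 2"
  using q_ge by (simp add: power2_eq_square)

lemma q_power_eq_E: "int q ^ (2 * s) = int q ^ 2 * E"
proof -
  have "2 * s = 2 + (2 * s - 2)" using s_ge by simp
  thus ?thesis unfolding E_def by (metis power_add)
qed

lemma n_mult_eq_E: "(int q + 1) * int n = int q ^ 2 * E - 1"
proof -
  have "1 \<le> q ^ (2 * s)" using q_ge by simp
  have "int ((q + 1) * n) = int (q ^ (2 * s)) - 1"
    unfolding n_eq using \<open>1 \<le> q ^ (2 * s)\<close> of_nat_diff[of 1 "q ^ (2 * s)", where ?'a = int] by simp
  thus ?thesis using q_power_eq_E by (simp add: algebra_simps)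
qed

text \<open>q^2 - 1 divides q^(2s) - 1, and the quotient is N = 1 + q^2 + ... + q^(2s-2). Its top
  term is E, whence the bounds E < N < 2E that follow.\<close>

lemma n_eq_mult_N: "int n = (int q - 1) * N" and N_mult_eq_E: "(int q ^ 2 - 1) * N = int q ^ 2 * E - 1"
proof -
  have "(int q ^ 2 - 1) dvd (int q ^ 2) ^ s - 1"
    by (metis dvd_triv_left power_diff_1_eq)
  hence "(int q ^ 2 - 1) dvd int q ^ 2 * E - 1"
    by (simp add: q_power_eq_E flip: power_mult)
  then obtain M where M: "int q ^ 2 * E - 1 = (int q ^ 2 - 1) * M" by blast
  have "(int q + 1) * int n = (int q + 1) * ((int q - 1) * M)"
    using n_mult_eq_E M by (simp add: algebra_simps power2_eq_square)
  hence nM: "int n = (int q - 1) * M"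
    using q_ge by simp
  hence "N = M" unfolding N_def using q_ge by simp
  thus "int n = (int q - 1) * N" "(int q ^ 2 - 1) * N = int q ^ 2 * E - 1"
    using nM M by auto
qed

lemma E_less_N: "E < N"
proof -
  have "(int q ^ 2 - 1) * (N - E) = E - 1"
    using N_mult_eq_E by (simp add: algebra_simps)
  moreover have "0 < E - 1" using E_ge q2_ge by simp
  ultimately have "0 < (int q ^ 2 - 1) * (N - E)" by simp
  thus ?thesis using q2_ge by (simp add: zero_less_mult_iff)
qed

lemma N_less_2E: "N < 2 * E"
proof -
  have "(int q ^ 2 - 1) * (2 * E - N) = (int q ^ 2 - 2) * E + 1"
    using N_mult_eq_E by (simp add: algebra_simps)
  moreover have "0 < (int q ^ 2 - 2) * E" using E_ge q2_ge by simp
  ultimately have "0 < (int q ^ 2 - 1) * (2 * E - N)" by linarith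
  thus ?thesis using q2_ge by (simp add: zero_less_mult_iff)
qed

lemma N_pos: "9 < N" using E_less_N E_ge q2_ge by linarith

lemma n_ge_2N: "2 * N \<le> int n"
  unfolding n_eq_mult_N using q_ge N_pos by (intro mult_right_mono) auto

lemma n_pos: "0 < n"
  using n_ge_2N N_pos by simp

section \<open>Coset equivalence modulo n\<close>

lemma sim_mult_E: "coset_sim q n (c * E) c" "coset_sim q n c (c * E)"
proof -
  have "int n dvd int q ^ 2 * E - 1" unfolding n_mult_eq_E[symmetric] by simp
  hence e: "[int q ^ 2 * E = 1] (mod int n)" by (simp add: cong_iff_dvd_diff)
  have "[c * (int q ^ 2 * E) = c * 1] (mod int n)" by (rule cong_scalar_left[OF e])
  hence "[c = c * E * int q ^ 2] (mod int n)" by (simp add: cong_sym mult_ac)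
  thus "coset_sim q n (c * E) c" by (rule coset_sim_powerI)
  show "coset_sim q n c (c * E)"
    by (rule coset_sim_powerI[of _ _ _ "2 * s - 2"]) (simp add: E_def)
qed

lemma q_power_1: "[int q ^ (2 * s) = 1] (mod int n)"
  using n_mult_eq_E q_power_eq_E by (metis cong_iff_dvd_diff dvd_triv_right)

text \<open>Since q^(2s) = 1 modulo n, multiplication by q^(k(2s-1)) undoes multiplication by
  q^k.\<close>

lemma sim_sym: assumes "x \<sim> y" shows "y \<sim> x"
proof -
  obtain k where k: "[y = x * int q ^ k] (mod int n)"
    using assms unfolding coset_sim_def by blast
  define l where "l = k * (2 * s - 1)"
  have "k + l = (2 * s) * k" unfolding l_def using s_ge
    by (cases s) (auto simp: algebra_simps)
  hence "int q ^ (k + l) = (int q ^ (2 * s)) ^ k" by (metis power_mult)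
  moreover have "[(int q ^ (2 * s)) ^ k = 1 ^ k] (mod int n)"
    by (rule cong_pow[OF q_power_1])
  ultimately have "[int q ^ (k + l) = 1] (mod int n)" by simp
  hence 1: "[x * int q ^ (k + l) = x * 1] (mod int n)" by (rule cong_scalar_left)
  have "[y * int q ^ l = x * int q ^ k * int q ^ l] (mod int n)"
    using k by (rule cong_scalar_right)
  with 1 have "[x = y * int q ^ l] (mod int n)"
    by (metis cong_sym cong_trans mult.assoc mult.right_neutral power_add)
  thus ?thesis by (rule coset_sim_powerI)
qed

lemma sim_0: "0 \<sim> x \<longleftrightarrow> int n dvd x"
  unfolding coset_sim_def by (simp add: cong_0_iff)

lemma sim_N: "c * N \<sim> x \<longleftrightarrow> [x = c * N] (mod int n)"
proof -
  have *: "[N * int q ^ k = N] (mod int n)" for k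
  proof (induction k)
    case (Suc k)
    have "int q * N = N + int n" using n_eq_mult_N by (simp add: algebra_simps)
    hence "[int q * N = N] (mod int n)" by (simp add: cong_def)
    moreover have "[int q * (N * int q ^ k) = int q * N] (mod int n)"
      by (rule cong_scalar_left[OF Suc])
    ultimately have "[int q * (N * int q ^ k) = N] (mod int n)" using cong_trans by blast
    thus ?case by (simp add: mult_ac)
  qed simp
  have "[c * N * int q ^ k = c * N] (mod int n)" for k
    using cong_scalar_left[OF *[of k], of c] by (simp add: mult_ac)
  thus ?thesis unfolding coset_sim_def
    by (metis cong_sym cong_trans)
qed

lemma cong_imp_eq_of_abs_diff_less:
  "[x = y] (mod int n) \<Longrightarrow> \<bar>x - y\<bar> < int n \<Longrightarrow> x = y"
  using dvd_imp_le_int[of "x - y" "int n"]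
  by (auto simp: cong_iff_dvd_diff)

text \<open>Recentres an index interval at a multiple of n inside it, which turns it into an
  interval of integers around 0.\<close>

lemma in_cosets_shift:
  assumes j0: "int n dvd int j0" "b \<le> j0" "j0 \<le> c"
  shows "in_cosets q n {b..c} x \<longleftrightarrow> (\<exists>j. int b - int j0 \<le> j \<and> j \<le> int c - int j0 \<and> j \<sim> x)"
proof
  assume "in_cosets q n {b..c} x"
  then obtain j where "b \<le> j" "j \<le> c" "int j \<sim> x"
    unfolding in_cosets_def by auto
  moreover have "[int j = int j - int j0] (mod int n)"
    using j0(1) by (simp add: cong_iff_dvd_diff)
  ultimately show "\<exists>j. int b - int j0 \<le> j \<and> j \<le> int c - int j0 \<and> j \<sim> x"
    by (intro exI[of _ "int j - int j0"]) (auto simp: coset_sim_cong[OF _ cong_refl])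
next
  assume "\<exists>j. int b - int j0 \<le> j \<and> j \<le> int c - int j0 \<and> j \<sim> x"
  then obtain j where j: "int b - int j0 \<le> j" "j \<le> int c - int j0" "j \<sim> x" by blast
  moreover have "[j = j + int j0] (mod int n)"
    using j0(1) by (simp add: cong_iff_dvd_diff)
  ultimately have "j + int j0 \<sim> x"
    by (metis coset_sim_cong cong_refl)
  thus "in_cosets q n {b..c} x"
    unfolding in_cosets_def using j(1,2)
    by (intro bexI[of _ "nat (j + int j0)"]) auto
qed

text \<open>The index 1 lies just outside the interval, but its coset is reached through q.\<close>

lemma in_cosets_1:
  assumes "q \<le> \<delta>" shows "in_cosets q n {2..\<delta>} 1"
proof -
  have "in_cosets q n {2..\<delta>} (int q)"
    using assms q_ge by (intro in_cosetsI) auto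
  moreover have "1 \<sim> int q"
    by (rule coset_sim_powerI[of _ _ _ 1]) simp
  ultimately show ?thesis using in_cosets_sim sim_sym by metis
qed

lemma q_less_n: "int q < int n - N"
proof -
  have "int q < N" using E_less_N E_ge q_le_q2 by linarith
  thus ?thesis using n_ge_2N by linarith
qed

subsection \<open>Intervals representing the dual zeros\<close>

text \<open>With [a, b] the dual interval shifted so as to contain 0, the bounds come in the order a
  >= -1, q <= \<delta>, a = 0, b < n', n - N <= \<delta>, b < q - 1, each resting on earlier
  ones.\<close>

lemma dual_interval_bounds:
  assumes \<delta>: "2 \<le> \<delta>" "\<delta> \<le> n" and b': "1 \<le> b'" "2 \<le> \<delta>'" "\<delta>' \<le> n"
    and H: "\<And>x. in_cosets q n {b'..b' + \<delta>' - 2} x \<longleftrightarrow> \<not> in_cosets q n {2..\<delta>} (- x)"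
  shows "\<delta> < n \<and> int n - N \<le> int \<delta> \<and>
    (\<forall>m. \<not> in_cosets q n {2..\<delta>} m \<longrightarrow> (\<exists>j. 0 \<le> j \<and> j \<le> int q - 2 \<and> j \<sim> -m))"
proof -
  let ?T = "in_cosets q n {2..\<delta>}"
  \<comment> \<open>For \<delta> = n every residue is covered, 0 by the index n and 1 through q, so
    nothing would be left for b'.\<close>
  have "\<delta> \<noteq> n"
  proof
    assume dn: "\<delta> = n"
    have "in_cosets q n {b'..b' + \<delta>' - 2} (int b')"
      using b' by (intro in_cosetsI) auto
    hence F: "\<not> ?T (- int b')" using H by simp
    define r where "r = (- int b') mod int n"
    have r: "0 \<le> r" "r < int n" "[r = - int b'] (mod int n)"
      unfolding r_def using n_pos by auto
    have "?T r"
    proof -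
      consider "r = 0" | "r = 1" | "2 \<le> r" using r(1) by linarith
      thus ?thesis
      proof cases
        case 1
        have "?T (int n)" using \<delta> dn by (intro in_cosetsI) auto
        moreover have "int n \<sim> 0" by (rule sim_sym) (simp add: sim_0)
        ultimately show ?thesis using 1 in_cosets_sim by blast
      next
        case 2
        thus ?thesis using in_cosets_1[of \<delta>] dn q_less_n N_pos by simp
      next
        case 3
        thus ?thesis using r dn by (intro in_cosetsI) auto
      qed
    qed
    moreover have "r \<sim> - int b'"
      using coset_sim_refl coset_sim_cong[OF cong_refl r(3)] by blast
    ultimately show False using F in_cosets_sim by blast
  qed
  hence dn: "\<delta> < n" using \<delta> by simp
  have "\<not> ?T 0"
  proof
    assume "?T 0"
    then obtain j where j: "2 \<le> j" "j \<le> \<delta>" "int j \<sim> 0" unfolding in_cosets_def by auto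
    hence "int n dvd int j" using sim_sym[OF j(3)] sim_0 by simp
    hence "n dvd j" by simp
    thus False using j dn by (auto dest: dvd_imp_le)
  qed
  hence "in_cosets q n {b'..b' + \<delta>' - 2} 0" using H by simp
  then obtain j0 where j0: "b' \<le> j0" "j0 \<le> b' + \<delta>' - 2" "int j0 \<sim> 0"
    unfolding in_cosets_def by auto
  have dv: "int n dvd int j0" using sim_sym[OF j0(3)] sim_0 by simp
  define a where "a = int b' - int j0"
  define b where "b = int (b' + \<delta>' - 2) - int j0"
  \<comment> \<open>The interval has \<delta>' - 1 <= n - 1 elements, so b < n, which keeps
    representatives in [0, b] unique modulo n.\<close>
  have ab: "a \<le> 0" "0 \<le> b" "b - a \<le> int n - 2"
    unfolding a_def b_def using j0 b' by auto
  define P where "P = (\<lambda>x. \<exists>j. a \<le> j \<and> j \<le> b \<and> j \<sim> x)"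
  have PT: "P x \<longleftrightarrow> \<not> ?T (- x)" for x
    unfolding P_def a_def b_def using in_cosets_shift[OF dv j0(1,2)] H by blast
  have PI: "P x" if "a \<le> x" "x \<le> b" for x
    unfolding P_def using that coset_sim_refl by blast
  have P_sim: "P y" if "P x" "x \<sim> y" for x y
    using that coset_sim_trans unfolding P_def by blast
  have TI: "?T x" if "2 \<le> x" "x \<le> int \<delta>" for x
    using that by (intro in_cosetsI) auto
  have notP: "\<not> P (- x)" if "2 \<le> x" "x \<le> int \<delta>" for x
    using TI[OF that] PT by simp
  \<comment> \<open>\<open>n - c * E\<close> lies in the coset of -c, which is excluded because c is
    an index of \<open>?T\<close>. As [a, b] contains 0, each such number that is nonnegative is a
    strict upper bound for b (\<open>b_less\<close>).\<close>
  have notPE: "\<not> P (int n - c * E)" if "2 \<le> c" "c \<le> int \<delta>" for c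
  proof -
    have "(-c) * E \<sim> - c" by (rule sim_mult_E)
    moreover have "[int n - c * E = (-c) * E] (mod int n)" by (simp add: cong_iff_dvd_diff)
    ultimately have "int n - c * E \<sim> -c" using coset_sim_cong[OF _ cong_refl] by blast
    thus ?thesis using notP[OF that] P_sim by blast
  qed
  have b_less: "b < x" if "\<not> P x" "0 \<le> x" for x
    using PI[of x] that ab(1) by linarith
  \<comment> \<open>The coset of \<open>c * N\<close> is a single residue, so only its own
    representative can cover it. The exception j = n - 1 is needed because -1 represents the same
    residue when a = -1.\<close>
  have P_multiple_N: "j \<le> b \<and> a \<le> j" if "P (c * N)" "[j = c * N] (mod int n)" "a < 0 \<longrightarrow> j \<noteq> int n - 1"
    "0 \<le> j" "j < int n" "a \<ge> -1" for j c
  proof -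
    from that(1) obtain i where i: "a \<le> i" "i \<le> b" "i \<sim> c * N"
      unfolding P_def by (elim exE conjE)
    hence "[i = c * N] (mod int n)" using sim_N[of c i] sim_sym[OF i(3)] by simp
    hence ij: "[i = j] (mod int n)" using that(2) cong_sym cong_trans by blast
    have "i = j"
    proof (cases "i = -1")
      case True
      hence "[int n - 1 = i] (mod int n)" by (simp add: cong_iff_dvd_diff)
      hence "[int n - 1 = j] (mod int n)" using ij cong_trans by blast
      hence "int n - 1 = j" using that by (intro cong_imp_eq_of_abs_diff_less) auto
      thus ?thesis using that(3) i(1) True by simp
    next
      case False
      hence "0 \<le> i" using i that by linarith
      hence "\<bar>i - j\<bar> < int n" using i(2) ab that(4,5) by linarith
      with ij show ?thesis by (rule cong_imp_eq_of_abs_diff_less)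
    qed
    thus ?thesis using i by simp
  qed
  have a_ge: "-1 \<le> a"
    using notP[of 2] PI[of "-2"] \<delta> ab by fastforce
  have N_ge: "9 < N" "N < int n - N + 1" using N_pos n_ge_2N by linarith+
  have mN: "[int n - N = (-1) * N] (mod int n)" by (simp add: cong_iff_dvd_diff)
  \<comment> \<open>If \<delta> < q, then N is not covered by \<open>?T\<close> and the dual
    interval must reach n - N; but c = 2 stops it before n - 2E, contrary to N < 2E.\<close>
  have qd: "q \<le> \<delta>"
  proof (rule ccontr)
    assume "\<not> q \<le> \<delta>"
    have "\<not> ?T N"
    proof
      assume "?T N"
      then obtain j where j: "2 \<le> j" "j \<le> \<delta>" "int j \<sim> N" unfolding in_cosets_def by auto
      hence "[int j = N] (mod int n)" using sim_N[of 1 "int j"] sim_sym[OF j(3)] by simp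
      hence "int j = N" using N_ge n_ge_2N j dn by (intro cong_imp_eq_of_abs_diff_less) auto
      thus False using j \<open>\<not> q \<le> \<delta>\<close> E_less_N E_ge q_le_q2 by linarith
    qed
    hence "P ((-1) * N)" using PT by simp
    hence "int n - N \<le> b"
      using P_multiple_N[OF _ mN] N_ge a_ge n_ge_2N by auto
    moreover have "b < int n - 2 * E"
      using notPE[of 2] \<delta> E_less_N n_ge_2N by (intro b_less) auto
    ultimately show False using N_less_2E by linarith
  qed
  have a0: "a = 0"
    using in_cosets_1[OF qd] PT[of "-1"] PI[of "-1"] a_ge ab by fastforce
  \<comment> \<open>This is \<open>n - c * E\<close> for c = q - 1, admissible since 2 <= q - 1 <=
    \<delta>. It satisfies q - 1 <= n' < N and bounds b.\<close>
  define n' where "n' = int n - (int q - 1) * E"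
  have n'_eq: "(int q + 1) * n' = E - 1"
    unfolding n'_def using n_mult_eq_E by (simp add: algebra_simps power2_eq_square)
  have "E - 1 \<ge> int q ^ 2 - 1" using E_ge by simp
  also have "int q ^ 2 - 1 = (int q + 1) * (int q - 1)"
    by (simp add: algebra_simps power2_eq_square)
  finally have n'_ge: "int q - 1 \<le> n'"
    unfolding n'_eq[symmetric] using q_ge by simp
  have "1 * n' \<le> (int q + 1) * n'" using n'_ge q_ge by (intro mult_right_mono) auto
  hence n'_less: "n' < N" using n'_eq E_less_N by simp
  have bn': "b < n'"
    unfolding n'_def using notPE[of "int q - 1"] q_ge qd n'_ge unfolding n'_def
    by (intro b_less) auto
  \<comment> \<open>N lies beyond b and is alone in its coset, so -N is covered by
    \<open>?T\<close>, necessarily through the index n - N. This yields the lower bound on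
    \<delta>.\<close>
  have "\<not> P N"
    using P_multiple_N[of 1 N] n'_less bn' a0 N_ge n_ge_2N by auto
  hence "?T (- N)" using PT by simp
  then obtain j where j: "2 \<le> j" "j \<le> \<delta>" "int j \<sim> (-1) * N" unfolding in_cosets_def by auto
  hence "[int j = (-1) * N] (mod int n)" using sim_N[of "-1" "int j"] sim_sym[OF j(3)] by simp
  hence "[int j = int n - N] (mod int n)" using mN cong_sym cong_trans by blast
  hence "int j = int n - N" using N_ge n_ge_2N j dn by (intro cong_imp_eq_of_abs_diff_less) auto
  hence Nd: "int n - N \<le> int \<delta>" using j by simp
  \<comment> \<open>Now n' < N <= n - N <= \<delta>, so n' is itself an index of \<open>?T\<close>.
    As n' lies in the coset of -(q - 1), the number q - 1 is excluded and the bound improves to b <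
    q - 1.\<close>
  have "?T n'" using n'_ge q_ge n'_less Nd n_ge_2N by (intro TI) auto
  moreover have "n' \<sim> - (int q - 1)"
  proof -
    have "(-(int q - 1)) * E \<sim> -(int q - 1)" by (rule sim_mult_E)
    moreover have "[n' = (-(int q - 1)) * E] (mod int n)"
      unfolding n'_def by (simp add: cong_iff_dvd_diff algebra_simps)
    ultimately show ?thesis using coset_sim_cong[OF _ cong_refl] by blast
  qed
  ultimately have "\<not> P (int q - 1)" using PT in_cosets_sim by blast
  hence "b < int q - 1" using q_ge by (intro b_less) auto
  hence "\<exists>j. 0 \<le> j \<and> j \<le> int q - 2 \<and> j \<sim> - m" if "\<not> ?T m" for m
  proof -
    have "P (- m)" using PT that by simp
    then obtain j where "0 \<le> j" "j \<le> b" "j \<sim> - m" unfolding P_def a0 by blast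
    thus ?thesis using \<open>b < int q - 1\<close> by (intro exI[of _ j]) auto
  qed
  thus ?thesis using dn Nd by blast
qed

abbreviation L :: nat where "L \<equiv> largest_coset_leader q n"

subsection \<open>The largest coset leader\<close>

lemma cyclotomic_coset_finite: "finite (cyclotomic_coset q n t)"
  by (rule finite_subset[of _ "{..<n}"]) (auto simp: cyclotomic_coset_iff[OF n_pos])

lemma coset_min:
  assumes "t < n"
  defines "u \<equiv> Min (cyclotomic_coset q n t)"
  shows "u < n" "int t \<sim> int u" "v < n \<Longrightarrow> int t \<sim> int v \<Longrightarrow> u \<le> v"
proof -
  have "t \<in> cyclotomic_coset q n t"
    using assms by (simp add: cyclotomic_coset_iff[OF n_pos] coset_sim_refl)
  hence "u \<in> cyclotomic_coset q n t"
    unfolding u_def using cyclotomic_coset_finite by (intro Min_in) auto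
  thus "u < n" "int t \<sim> int u" by (auto simp: cyclotomic_coset_iff[OF n_pos])
  show "u \<le> v" if "v < n" "int t \<sim> int v"
    unfolding u_def using that cyclotomic_coset_finite
    by (intro Min_le) (auto simp: cyclotomic_coset_iff[OF n_pos])
qed

lemma coset_leaders_finite: "finite (coset_leaders q n)"
proof -
  have "coset_leaders q n = (\<lambda>t. Min (cyclotomic_coset q n t)) ` {..<n}"
    unfolding coset_leaders_def by auto
  thus ?thesis by simp
qed

lemma largest_leader: "L < n" "v < n \<Longrightarrow> int L \<sim> int v \<Longrightarrow> L \<le> v"
proof -
  have "coset_leaders q n \<noteq> {}"
    unfolding coset_leaders_def using n_pos by auto
  hence "L \<in> coset_leaders q n"
    unfolding largest_coset_leader_def using coset_leaders_finite by (intro Max_in) auto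
  then obtain t where t: "t < n" "L = Min (cyclotomic_coset q n t)"
    unfolding coset_leaders_def by auto
  note m = coset_min[OF t(1), folded t(2)]
  show "L < n" by (rule m)
  show "L \<le> v" if "v < n" "int L \<sim> int v"
    using m(3)[OF that(1)] coset_sim_trans[OF m(2) that(2)] by blast
qed

lemma leader_exists:
  obtains u where "u < n" "x \<sim> int u" "u \<le> L" "\<And>v. v < n \<Longrightarrow> x \<sim> int v \<Longrightarrow> u \<le> v"
proof -
  define t where "t = nat (x mod int n)"
  have t: "int t = x mod int n" unfolding t_def using n_pos by simp
  hence tn: "t < n" using n_pos pos_mod_bound[of "int n" x] by linarith
  define u where "u = Min (cyclotomic_coset q n t)"
  note m = coset_min[OF tn, folded u_def]
  have "[int t = x] (mod int n)" using t by (simp add: cong_def)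
  hence sim: "int t \<sim> y \<longleftrightarrow> x \<sim> y" for y using coset_sim_cong[OF _ cong_refl] by blast
  have "u \<in> coset_leaders q n" unfolding coset_leaders_def u_def using tn by blast
  hence "u \<le> L" unfolding largest_coset_leader_def using coset_leaders_finite by (intro Max_ge)
  thus ?thesis using that m sim by blast
qed

text \<open>Only the leaders 0 and 1 lie below the interval: 0 is ruled out by the divisibility
  assumption, and 1 is reached through q.\<close>

lemma in_cosets_leader:
  assumes "q \<le> \<delta>" "\<not> int n dvd x" "x \<sim> int u" "u \<le> \<delta>"
  shows "in_cosets q n {2..\<delta>} x"
proof -
  have "in_cosets q n {2..\<delta>} (int u)"
  proof -
    consider "u = 0" | "u = 1" | "2 \<le> u" by linarith
    thus ?thesis
    proof cases
      case 1
      hence "0 \<sim> x" using sim_sym[OF assms(3)] by simp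
      thus ?thesis using assms(2) sim_0 by blast
    next
      case 2
      thus ?thesis using in_cosets_1[OF assms(1)] by simp
    next
      case 3
      thus ?thesis using assms by (intro in_cosetsI) auto
    qed
  qed
  thus ?thesis using sim_sym[OF assms(3)] in_cosets_sim by blast
qed

lemma not_in_cosets_multiple:
  assumes "\<delta> < n" "int n dvd x"
  shows "\<not> in_cosets q n {2..\<delta>} x"
proof
  assume "in_cosets q n {2..\<delta>} x"
  then obtain j where j: "2 \<le> j" "j \<le> \<delta>" "int j \<sim> x" unfolding in_cosets_def by auto
  have "0 \<sim> int j" using coset_sim_trans[of q n 0 x] sim_sym[OF j(3)] assms(2) sim_0 by blast
  hence "n dvd j" using sim_0 by simp
  thus False using j assms by (auto dest: dvd_imp_le)
qed

text \<open>Negation carries a coset inside 1..M to one inside n - M..n - 1, and the leader of the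
  latter is at least n - M.\<close>

lemma largest_leader_ge:
  assumes w: "\<And>k. \<exists>z. 0 < z \<and> z \<le> M \<and> [w * int q ^ k = z] (mod int n)" and M: "M < int n"
  shows "int n - M \<le> int L"
proof -
  obtain u where u: "u < n" "- w \<sim> int u" "u \<le> L" using leader_exists by metis
  have "w \<sim> - int u" using u(2) coset_sim_uminus_iff by blast
  then obtain k where "[- int u = w * int q ^ k] (mod int n)" unfolding coset_sim_def by blast
  moreover obtain z where z: "0 < z" "z \<le> M" "[w * int q ^ k = z] (mod int n)" using w by blast
  ultimately have "[- int u = z] (mod int n)" using cong_trans by blast
  moreover have "[int n - int u = - int u] (mod int n)" by (simp add: cong_iff_dvd_diff)
  ultimately have "[int n - int u = z] (mod int n)" using cong_trans by blast
  moreover have "\<bar>int n - int u - z\<bar> < int n" using u z M by linarith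
  ultimately have "int n - int u = z" by (rule cong_imp_eq_of_abs_diff_less)
  thus ?thesis using z u by linarith
qed

text \<open>Applied to -L, the assumption gives z >= M with n - z in the coset of L, where L is
  least.\<close>

lemma largest_leader_le:
  assumes "\<And>y. 0 < y \<Longrightarrow> y < int n \<Longrightarrow> \<exists>z. M \<le> z \<and> z < int n \<and> y \<sim> z" "M \<le> int n"
  shows "int L \<le> int n - M"
proof (cases "L = 0")
  case False
  then obtain z where z: "M \<le> z" "z < int n" "int n - int L \<sim> z"
    using assms(1)[of "int n - int L"] largest_leader(1) by auto
  show ?thesis
  proof (cases "z \<le> 0")
    case True
    thus ?thesis using z largest_leader(1) by linarith
  next
    case False
    have "[int n - int L = - int L] (mod int n)" by (simp add: cong_iff_dvd_diff)
    hence "- int L \<sim> z" using z(3) coset_sim_cong[OF _ cong_refl] by blast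
    hence "int L \<sim> - z" using coset_sim_uminus_iff by blast
    moreover have "[- z = int n - z] (mod int n)" by (simp add: cong_iff_dvd_diff)
    ultimately have "int L \<sim> int n - z" using coset_sim_cong[OF cong_refl] by blast
    hence "int L \<sim> int (nat (int n - z))" using z by simp
    moreover have "nat (int n - z) < n" using z False by linarith
    ultimately have "L \<le> nat (int n - z)" using largest_leader(2) by blast
    thus ?thesis using z by linarith
  qed
qed (use assms in simp)

lemma E_s2: "s = 2 \<Longrightarrow> E = int q ^ 2"
  unfolding E_def by simp

text \<open>The coset of 1 is 1, q, q^2, q^2 - q + 1, with maximum q^2; negating it gives the lower
  bound. For the upper bound every nonzero coset is shown to have a member of size at least
  q^2.\<close>

lemma largest_leader_s2: assumes "s = 2" shows "int L = int n - int q ^ 2"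
proof -
  define r where "r = int q"
  have r: "3 \<le> r" using q_ge r_def by simp
  have E: "E = r ^ 2" unfolding r_def using assms by (rule E_s2)
  have "(r + 1) * int n = (r + 1) * ((r - 1) * (r ^ 2 + 1))"
    using n_mult_eq_E E unfolding r_def by (simp add: algebra_simps power2_eq_square)
  hence n: "int n = (r - 1) * (r ^ 2 + 1)" using r by simp
  have rr: "3 * r \<le> r ^ 2" using r by (simp add: power2_eq_square)
  have nge: "2 * (r ^ 2 + 1) \<le> int n" unfolding n using r by (intro mult_right_mono) auto
  have "\<exists>z. 0 < z \<and> z \<le> r ^ 2 \<and> [1 * int q ^ k = z] (mod int n)" for k
  proof -
    have "\<exists>z\<in>{1, r, r ^ 2, r ^ 2 - r + 1}. [r ^ k = z] (mod int n)"
    proof (induction k)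
      case (Suc k)
      then obtain z where z: "z \<in> {1, r, r ^ 2, r ^ 2 - r + 1}" "[r ^ k = z] (mod int n)" by blast
      have *: "[r ^ Suc k = r * z] (mod int n)" using cong_scalar_left[OF z(2)] by simp
      have "[r * r ^ 2 = r ^ 2 - r + 1] (mod int n)" "[r * (r ^ 2 - r + 1) = 1] (mod int n)"
        unfolding cong_iff_dvd_diff n
        by (auto simp: algebra_simps power2_eq_square intro!: dvdI[of _ _ 1])
      moreover have "r * r = r ^ 2" by (simp add: power2_eq_square)
      ultimately show ?case using z(1) cong_trans[OF *] * by auto
    qed auto
    then obtain z where z: "z \<in> {1, r, r ^ 2, r ^ 2 - r + 1}" "[r ^ k = z] (mod int n)" by blast
    have "r \<le> r ^ 2" "1 \<le> r ^ 2" using rr r by linarith+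
    hence "0 < z \<and> z \<le> r ^ 2" using z(1) r by auto
    thus ?thesis using z(2) unfolding r_def[symmetric] by auto
  qed
  hence "int n - r ^ 2 \<le> int L" using nge rr r by (intro largest_leader_ge[of "r ^ 2" 1]) auto
  moreover have "int L \<le> int n - r ^ 2"
  proof (rule largest_leader_le)
    fix y assume y: "0 < y" "y < int n"
    \<comment> \<open>Small y need only a factor q^2 or q and no reduction. The number q^2 - q + 1
      is q^3 modulo n and leads to q^2; the remaining y are q^3 + i modulo n, and multiplication by
      q^2 gives i q^2 + q because q^4 = 1.\<close>
    consider "r ^ 2 \<le> y" | "y \<le> r - 1" | "r \<le> y" "y \<le> r ^ 2 - r" | "y = r ^ 2 - r + 1"
      | "r ^ 2 - r + 2 \<le> y" "y \<le> r ^ 2 - 1" by linarith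
    thus "\<exists>z. r ^ 2 \<le> z \<and> z < int n \<and> y \<sim> z"
    proof cases
      case 1
      thus ?thesis using y coset_sim_refl by blast
    next
      case 2
      have "1 * r ^ 2 \<le> y * r ^ 2" "y * r ^ 2 \<le> (r - 1) * r ^ 2"
        using y 2 by (intro mult_right_mono; simp)+
      moreover have "(r - 1) * r ^ 2 < int n" unfolding n using r by simp
      moreover have "y \<sim> y * r ^ 2" by (rule coset_sim_powerI[of _ _ _ 2]) (simp add: r_def)
      ultimately show ?thesis by (intro exI[of _ "y * r ^ 2"]) auto
    next
      case 3
      have "r * r \<le> y * r" "y * r \<le> (r ^ 2 - r) * r" using r 3 by (intro mult_right_mono; simp)+
      moreover have "(r ^ 2 - r) * r < int n"
        unfolding n using r by (simp add: algebra_simps power2_eq_square)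
      moreover have "y \<sim> y * r" by (rule coset_sim_powerI[of _ _ _ 1]) (simp add: r_def)
      ultimately show ?thesis by (intro exI[of _ "y * r"]) (auto simp: power2_eq_square)
    next
      case 4
      have "y \<sim> r ^ 2"
      proof (rule coset_sim_powerI[of _ _ _ 3])
        have "(r ^ 2 - r + 1) * r ^ 3 - r ^ 2 = int n * r ^ 2"
          unfolding n by (simp add: algebra_simps power2_eq_square power3_eq_cube)
        thus "[r ^ 2 = y * int q ^ 3] (mod int n)"
          unfolding 4 r_def[symmetric] by (metis cong_iff_dvd_diff cong_sym dvd_triv_left)
      qed
      thus ?thesis using nge rr r by (intro exI[of _ "r ^ 2"]) auto
    next
      case 5
      define i where "i = y - (r ^ 2 - r + 1)"
      have i: "1 \<le> i" "i \<le> r - 2" unfolding i_def using 5 by auto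
      have "y \<sim> i * r ^ 2 + r"
      proof (rule coset_sim_powerI[of _ _ _ 2])
        have "(r ^ 2 - r + 1 + i) * r ^ 2 - (i * r ^ 2 + r) = int n * r"
          unfolding n by (simp add: algebra_simps power2_eq_square)
        moreover have "y = r ^ 2 - r + 1 + i" unfolding i_def by simp
        ultimately show "[i * r ^ 2 + r = y * int q ^ 2] (mod int n)"
          unfolding r_def[symmetric] by (metis cong_iff_dvd_diff cong_sym dvd_triv_left)
      qed
      moreover have "1 * r ^ 2 \<le> i * r ^ 2" "i * r ^ 2 \<le> (r - 2) * r ^ 2"
        using i by (intro mult_right_mono; simp)+
      moreover have "(r - 2) * r ^ 2 + r < int n"
        unfolding n using r rr by (simp add: algebra_simps)
      ultimately have "y \<sim> i * r ^ 2 + r" "r ^ 2 \<le> i * r ^ 2 + r" "i * r ^ 2 + r < int n"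
        using r by (simp, linarith, linarith)
      thus ?thesis by blast
    qed
  next
    have "0 \<le> r ^ 2" by simp
    thus "r ^ 2 \<le> int n" using nge by simp
  qed
  ultimately show ?thesis unfolding r_def by simp
qed

text \<open>By negation it is enough that all residues in the coset of w = q^2 - q + 1 lie strictly
  between 0 and E.\<close>

lemma largest_leader_s3: assumes "3 \<le> s" shows "int n - E < int L"
proof -
  define r where "r = int q"
  have r: "3 \<le> r" using q_ge r_def by simp
  define w where "w = r ^ 2 - r + 1"
  define F where "F = r ^ (2 * s - 3)"
  have E: "E = r * F"
  proof -
    have "2 * s - 2 = Suc (2 * s - 3)" using assms by simp
    thus ?thesis unfolding E_def F_def r_def by simp
  qed
  have "r ^ 3 \<le> F" unfolding F_def using r assms by (intro power_increasing) auto
  moreover have "r * r ^ 2 \<le> r ^ 3" by (simp add: power2_eq_square power3_eq_cube)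
  moreover have "3 * r ^ 2 \<le> r * r ^ 2" using r by (intro mult_right_mono) auto
  moreover have "3 * r \<le> r ^ 2" using r by (simp add: power2_eq_square)
  \<comment> \<open>This makes the estimate v q^2 < E strict; for s = 2 one would have F = q, v = 1
    and v q^2 = E.\<close>
  ultimately have rF: "r < F" using r by linarith
  \<comment> \<open>The residue of w q^(2s-3), the first multiple of w in its orbit that exceeds n.
    The last three exponents give v, v q and v q^2.\<close>
  define v where "v = w * F - int n"
  have v: "(r + 1) * v = F + 1"
    using n_mult_eq_E unfolding v_def w_def E r_def[symmetric]
    by (simp add: algebra_simps power2_eq_square)
  have v_pos: "0 < v"
    using v rF r by (smt (verit) zero_less_mult_iff)
  have w: "0 < w" "w < r ^ 2" unfolding w_def using r by (auto simp: power2_eq_square)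
  have "\<exists>z. 0 < z \<and> z \<le> E - 1 \<and> [w * int q ^ k = z] (mod int n)" for k
  proof -
    define m where "m = k mod (2 * s)"
    have m: "m < 2 * s" unfolding m_def using assms by simp
    have "r ^ k = (r ^ (2 * s)) ^ (k div (2 * s)) * r ^ m"
      unfolding m_def power_mult[symmetric] power_add[symmetric] by simp
    moreover have "[(r ^ (2 * s)) ^ (k div (2 * s)) = 1 ^ (k div (2 * s))] (mod int n)"
      unfolding r_def by (rule cong_pow[OF q_power_1])
    ultimately have "[r ^ k = r ^ m] (mod int n)"
      using cong_scalar_right[of "(r ^ (2 * s)) ^ (k div (2 * s))" 1 "int n" "r ^ m"] by simp
    hence k: "[w * r ^ k = w * r ^ m] (mod int n)" by (rule cong_scalar_left)
    show ?thesis
    proof (cases "m \<le> 2 * s - 4")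
      case True
      have "w * r ^ m \<le> w * r ^ (2 * s - 4)"
        using True w r by (intro mult_left_mono power_increasing) auto
      also have "\<dots> < r ^ 2 * r ^ (2 * s - 4)"
        using w r by (intro mult_strict_right_mono) auto
      also have "\<dots> = E"
      proof -
        have "2 * s - 2 = 2 + (2 * s - 4)" using assms by simp
        thus ?thesis unfolding E_def r_def by (metis power_add)
      qed
      finally show ?thesis using k w r unfolding r_def by (intro exI[of _ "w * int q ^ m"]) auto
    next
      case False
      define i where "i = m - (2 * s - 3)"
      have i: "i \<le> 2" "m = (2 * s - 3) + i" unfolding i_def using False m by auto
      have "w * r ^ m = w * F * r ^ i" unfolding i(2) F_def by (simp add: power_add)
      also have "[w * F * r ^ i = v * r ^ i] (mod int n)"
        by (rule cong_scalar_right) (simp add: v_def cong_iff_dvd_diff)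
      finally have "[w * r ^ k = v * r ^ i] (mod int n)" using k cong_trans by blast
      moreover have "v * r ^ i < E"
      proof -
        have "v * r ^ i \<le> v * r ^ 2" using i v_pos r by (intro mult_left_mono power_increasing) auto
        moreover have "(r + 1) * (v * r ^ 2) = r * (r * F + r)"
          using v by (simp add: mult.assoc[symmetric]) (simp add: algebra_simps power2_eq_square)
        moreover have "r * (r * F + r) < r * ((r + 1) * F)"
          using rF r by (intro mult_strict_left_mono) (auto simp: algebra_simps)
        ultimately have "(r + 1) * (v * r ^ 2) < (r + 1) * E"
          unfolding E by (simp add: mult_ac)
        hence "v * r ^ 2 < E" using r by (simp add: mult_less_cancel_left)
        thus ?thesis using \<open>v * r ^ i \<le> v * r ^ 2\<close> by linarith
      qed
      ultimately show ?thesis using v_pos r unfolding r_def by (intro exI[of _ "v * int q ^ i"]) auto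
    qed
  qed
  hence "int n - (E - 1) \<le> int L"
    using E_less_N n_ge_2N N_pos by (intro largest_leader_ge[of "E - 1" w]) auto
  thus ?thesis by simp
qed

subsection \<open>The dual zeros as an interval\<close>

text \<open>The purely arithmetic form of the dually-BCH property; \<open>dual_root_code_iff\<close>
  translates it into codes.\<close>

definition dual_interval :: "nat \<Rightarrow> bool" where
  "dual_interval \<delta> \<longleftrightarrow> (\<exists>b \<delta>'. 1 \<le> b \<and> 2 \<le> \<delta>' \<and> \<delta>' \<le> n \<and>
    (\<forall>x. in_cosets q n {b..b + \<delta>' - 2} x \<longleftrightarrow> \<not> in_cosets q n {2..\<delta>} (- x)))"

text \<open>Every nonzero coset has its leader at most \<delta>, so 0 is the only residue left over.
  The interval {n} serves, n standing for 0 because b >= 1 is required.\<close>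

lemma dual_interval_if_L_le:
  assumes "q \<le> \<delta>" "L \<le> \<delta>" "\<delta> < n"
  shows "dual_interval \<delta>"
proof -
  have "in_cosets q n {n..n + 2 - 2} x \<longleftrightarrow> \<not> in_cosets q n {2..\<delta>} (- x)" for x
  proof -
    have "int n \<sim> x \<longleftrightarrow> 0 \<sim> x"
      by (rule coset_sim_cong) (simp_all add: cong_def)
    hence "in_cosets q n {n..n + 2 - 2} x \<longleftrightarrow> int n dvd x"
      unfolding in_cosets_def by (simp add: sim_0)
    moreover have "in_cosets q n {2..\<delta>} (- x)" if "\<not> int n dvd x"
    proof -
      obtain u where "- x \<sim> int u" "u \<le> L" using leader_exists by metis
      thus ?thesis using assms that by (intro in_cosets_leader[of _ _ u]) auto
    qed
    ultimately show ?thesis using not_in_cosets_multiple[OF assms(3), of "-x"] by auto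
  qed
  moreover have "1 \<le> n" "2 \<le> n" using N_pos n_ge_2N by linarith+
  ultimately show ?thesis unfolding dual_interval_def by blast
qed

text \<open>Besides 0 only the coset of L is left over. As L = n - E, it is the coset of -1, so the
  dual interval is {n, n + 1}, representing 0 and 1.\<close>

lemma dual_interval_s2:
  assumes s: "s = 2" and \<delta>: "L - 1 = \<delta>"
  shows "dual_interval \<delta>"
proof -
  have L: "int L = int n - int q ^ 2" by (rule largest_leader_s2[OF s])
  have E: "E = int q ^ 2" using s by (rule E_s2)
  have N: "N > int q ^ 2" using E_less_N E by simp
  have "int q ^ 2 < int n" using N N_pos n_ge_2N by linarith
  have Lq: "int q < int L"
    using L N n_ge_2N q_le_q2 q_ge by linarith
  have "in_cosets q n {n..n + 3 - 2} x \<longleftrightarrow> \<not> in_cosets q n {2..\<delta>} (- x)" for x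
  proof -
    have "int n \<sim> x \<longleftrightarrow> 0 \<sim> x"
      by (rule coset_sim_cong) (simp_all add: cong_def)
    moreover have "int (n + 1) \<sim> x \<longleftrightarrow> 1 \<sim> x"
      by (rule coset_sim_cong) (simp_all add: cong_def)
    moreover have "{n..n + 3 - 2} = {n, n + 1}" by auto
    ultimately have "in_cosets q n {n..n + 3 - 2} x \<longleftrightarrow> int n dvd x \<or> 1 \<sim> x"
      unfolding in_cosets_def by (simp add: sim_0)
    moreover have "1 \<sim> x \<longleftrightarrow> int L \<sim> - x"
    proof -
      have "[int L = (-1) * E] (mod int n)"
        unfolding L E by (simp add: cong_iff_dvd_diff)
      hence "int L \<sim> - x \<longleftrightarrow> (-1) * E \<sim> - x" by (rule coset_sim_cong) simp
      also have "\<dots> \<longleftrightarrow> -1 \<sim> - x"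
        using sim_mult_E[of "-1"] coset_sim_trans by blast
      also have "\<dots> \<longleftrightarrow> 1 \<sim> x" using coset_sim_uminus_iff[of q n 1 "-x"] by simp
      finally show ?thesis by simp
    qed
    moreover have "in_cosets q n {2..\<delta>} (- x)" if "\<not> int n dvd x" "\<not> int L \<sim> - x"
    proof -
      obtain u where u: "- x \<sim> int u" "u \<le> L" using leader_exists by metis
      have "u \<noteq> L" using sim_sym[OF u(1)] that(2) by blast
      thus ?thesis using that(1) u \<delta> Lq by (intro in_cosets_leader[of _ _ u]) auto
    qed
    moreover have "\<not> in_cosets q n {2..\<delta>} (- x)" if "int L \<sim> - x"
    proof
      assume "in_cosets q n {2..\<delta>} (- x)"
      then obtain j where j: "2 \<le> j" "j \<le> \<delta>" "int j \<sim> - x" unfolding in_cosets_def by auto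
      hence "int L \<sim> int j" using coset_sim_trans[OF that sim_sym[OF j(3)]] by blast
      moreover have "j < n" using j \<delta> largest_leader(1) by linarith
      ultimately have "L \<le> j" by (intro largest_leader(2))
      thus False using j \<delta> by linarith
    qed
    moreover have "\<not> in_cosets q n {2..\<delta>} (- x)" if "int n dvd x"
      using that \<delta> largest_leader(1) by (intro not_in_cosets_multiple) auto
    ultimately show ?thesis by blast
  qed
  moreover have "1 \<le> n" "3 \<le> n" "(2::nat) \<le> 3" using N_pos n_ge_2N by linarith+
  ultimately show ?thesis unfolding dual_interval_def by blast
qed

theorem dual_interval_iff:
  assumes \<delta>: "2 \<le> \<delta>" "\<delta> \<le> n"
  shows "dual_interval \<delta> \<longleftrightarrow> (if s = 2 then L - 1 \<le> \<delta> else L \<le> \<delta>) \<and> \<delta> \<le> n - 1"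
proof
  assume "dual_interval \<delta>"
  then obtain b \<delta>' where b: "1 \<le> b" "2 \<le> \<delta>'" "\<delta>' \<le> n"
    "\<And>x. in_cosets q n {b..b + \<delta>' - 2} x \<longleftrightarrow> \<not> in_cosets q n {2..\<delta>} (- x)"
    unfolding dual_interval_def by (elim exE conjE) (rule that, assumption+, blast)
  note bounds = dual_interval_bounds[OF \<delta> b]
  hence B: "\<delta> < n" "int n - N \<le> int \<delta>" by simp_all
  \<comment> \<open>Here N = q^2 + 1 and L = n - q^2, so n - N is exactly L - 1.\<close>
  have "L - 1 \<le> \<delta>" if s: "s = 2"
  proof -
    have "E = int q ^ 2" using s by (rule E_s2)
    hence "(int q ^ 2 - 1) * N = (int q ^ 2 - 1) * (int q ^ 2 + 1)"
      using N_mult_eq_E by (simp add: algebra_simps)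
    hence "N = int q ^ 2 + 1" using q2_ge by simp
    thus ?thesis using B largest_leader_s2[OF s] by linarith
  qed
  moreover have "L \<le> \<delta>" if "s \<noteq> 2"
  proof (rule ccontr)
    assume less: "\<not> L \<le> \<delta>"
    have Lb: "int n - E < int L" using that s_ge by (intro largest_leader_s3) auto
    \<comment> \<open>L is least in its coset, so a smaller \<delta> misses it, and -L is then
      represented by some j <= q - 2. A nonzero j puts n - jE <= n - E < L into the coset of L,
      against minimality.\<close>
    have "\<not> in_cosets q n {2..\<delta>} (int L)"
    proof
      assume "in_cosets q n {2..\<delta>} (int L)"
      then obtain j where j: "2 \<le> j" "j \<le> \<delta>" "int j \<sim> int L" unfolding in_cosets_def by auto
      have "L \<le> j" using largest_leader(2)[OF _ sim_sym[OF j(3)]] j(2) B(1) by simp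
      thus False using j less by linarith
    qed
    then obtain j where j: "0 \<le> j" "j \<le> int q - 2" "j \<sim> - int L" using bounds by blast
    show False
    proof (cases "j = 0")
      case True
      hence "int n dvd int L" using j sim_0 by simp
      hence "L = 0" using largest_leader(1) by (auto dest: dvd_imp_le)
      thus ?thesis using Lb E_less_N n_ge_2N N_pos by linarith
    next
      case False
      hence jE: "1 * E \<le> j * E" "j * E \<le> (int q - 1) * E"
        using j E_ge q2_ge by (intro mult_right_mono; simp)+
      have "(int q - 1) * E < int n" unfolding n_eq_mult_N using E_less_N q_ge by simp
      hence un: "j * E < int n" using jE by linarith
      have "int L \<sim> - j" using sim_sym[OF j(3)] coset_sim_uminus_iff by blast
      moreover have "- j \<sim> (- j) * E" by (rule sim_mult_E)
      moreover have "(- j) * E \<sim> int n - j * E"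
        by (rule coset_sim_powerI[of _ _ _ 0]) (simp add: cong_iff_dvd_diff)
      ultimately have "int L \<sim> int n - j * E" using coset_sim_trans by blast
      hence "int L \<sim> int (nat (int n - j * E))" using un by simp
      moreover have "nat (int n - j * E) < n" using jE E_ge q2_ge un by linarith
      ultimately have "L \<le> nat (int n - j * E)" by (intro largest_leader(2))
      thus ?thesis using Lb jE un by linarith
    qed
  qed
  moreover have "\<delta> \<le> n - 1" using B by linarith
  ultimately show "(if s = 2 then L - 1 \<le> \<delta> else L \<le> \<delta>) \<and> \<delta> \<le> n - 1" by simp
next
  assume R: "(if s = 2 then L - 1 \<le> \<delta> else L \<le> \<delta>) \<and> \<delta> \<le> n - 1"
  hence dn: "\<delta> < n" using n_pos by linarith
  have Lq: "int q < int L"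
  proof -
    have "int n - E \<le> int L"
    proof (cases "s = 2")
      case True
      thus ?thesis using largest_leader_s2 E_s2 by simp
    next
      case False
      thus ?thesis using largest_leader_s3 s_ge by simp
    qed
    thus ?thesis using E_less_N n_ge_2N E_ge q_le_q2 q_ge by linarith
  qed
  show "dual_interval \<delta>"
  proof (cases "L \<le> \<delta>")
    case True
    thus ?thesis using dual_interval_if_L_le dn Lq by simp
  next
    case False
    hence "s = 2" "L - 1 = \<delta>" using R by (auto split: if_splits)
    thus ?thesis by (rule dual_interval_s2)
  qed
qed

end

subsection \<open>Finite fields and minimal polynomials\<close>

text \<open>Multiplication by a nonzero x permutes the nonzero elements; comparing their products
  gives the claim.\<close>

lemma finite_field_power_card:
  fixes x :: "'a::field"
  assumes "finite (UNIV :: 'a set)"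
  shows "x ^ card (UNIV :: 'a set) = x"
proof (cases "x = 0")
  case False
  define U where "U = UNIV - {0 :: 'a}"
  have U: "finite U" "card (UNIV :: 'a set) = Suc (card U)"
    unfolding U_def using assms by (simp_all add: card_Suc_Diff1 del: card_Diff_insert)
  have "bij_betw ((*) x) U U"
    by (rule bij_betwI[of _ _ _ "\<lambda>y. y / x"]) (use False in \<open>auto simp: U_def\<close>)
  hence "\<Prod>U = (\<Prod>y\<in>U. x * y)"
    by (rule prod.reindex_bij_betw[symmetric])
  also have "\<dots> = x ^ card U * \<Prod>U" by (simp add: prod.distrib)
  finally have "x ^ card U = 1"
    using U(1) by (simp add: U_def)
  thus ?thesis by (simp add: U)
qed (use assms in \<open>simp add: finite_UNIV_card_ge_0\<close>)

text \<open>The minimal polynomial exists as soon as \<open>x\<close> is algebraic, so the \<open>THE\<close> in its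
  definition is not a junk value.\<close>

lemma CHAR_dvd_card_UNIV:
  assumes "finite (UNIV :: 'a::ring_1 set)"
  shows "CHAR('a) dvd card (UNIV :: 'a set)"
proof -
  \<comment> \<open>Translation by 1 permutes the ring, so the ones contribute 0 to the sum.\<close>
  have "(\<Sum>x\<in>UNIV. x + 1) = (\<Sum>x\<in>UNIV. x :: 'a)"
    by (rule sum.reindex_bij_witness[of _ "\<lambda>x. x - 1" "\<lambda>x. x + 1"]) auto
  hence "of_nat (card (UNIV :: 'a set)) = (0 :: 'a)" by (simp add: sum.distrib)
  thus ?thesis by (simp add: of_nat_eq_0_iff_char_dvd)
qed

text \<open>A nonzero annihilator of least degree, made monic, divides all annihilators by division
  with remainder; this also makes it unique.\<close>

lemma (in field_hom) min_poly_dvd_iff: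
  assumes "f \<noteq> 0" "poly (map_poly hom f) x = 0"
  shows "min_poly hom x dvd p \<longleftrightarrow> poly (map_poly hom p) x = 0"
proof -
  interpret map_poly_hom: map_poly_idom_hom hom ..
  define R where "R = (\<lambda>p. poly (map_poly hom p) x = 0)"
  define m0 where "m0 = arg_min degree (\<lambda>p. p \<noteq> 0 \<and> R p)"
  have "f \<noteq> 0 \<and> R f" using assms unfolding R_def by simp
  hence m0: "m0 \<noteq> 0" "R m0" "\<And>p. p \<noteq> 0 \<Longrightarrow> R p \<Longrightarrow> degree m0 \<le> degree p"
    unfolding m0_def using arg_min_nat_lemma[of "\<lambda>p. p \<noteq> 0 \<and> R p" f degree] by auto
  define m where "m = Polynomial.smult (inverse (lead_coeff m0)) m0"
  have m: "lead_coeff m = 1" "R m" "\<And>p. p \<noteq> 0 \<Longrightarrow> R p \<Longrightarrow> degree m \<le> degree p"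
    using m0 unfolding m_def R_def by (simp_all add: map_poly_hom_smult)
  have dvd: "m dvd p \<longleftrightarrow> R p" for p
  proof
    assume "m dvd p"
    then obtain k where "p = m * k" ..
    thus "R p" using m(2) unfolding R_def by (simp add: map_poly_hom.hom_mult)
  next
    assume "R p"
    have m_nz: "m \<noteq> 0" using m(1) by auto
    have "R (p mod m)"
    proof -
      have "p mod m = p - m * (p div m)" by (simp add: minus_mult_div_eq_mod)
      thus ?thesis using \<open>R p\<close> m(2) unfolding R_def
        by (simp add: map_poly_hom.hom_mult map_poly_hom.hom_minus)
    qed
    hence "p mod m = 0"
      using m(3)[of "p mod m"] degree_mod_less[OF m_nz, of p] by (metis not_le)
    thus "m dvd p" by (simp add: mod_eq_0_iff_dvd)
  qed
  have "min_poly hom x = m" unfolding min_poly_def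
  proof (rule the_equality)
    show "lead_coeff m = 1 \<and> poly (map_poly hom m) x = 0 \<and>
        (\<forall>p'. p' \<noteq> 0 \<and> poly (map_poly hom p') x = 0 \<longrightarrow> degree m \<le> degree p')"
      using m unfolding R_def by blast
  next
    fix p assume p: "lead_coeff p = 1 \<and> poly (map_poly hom p) x = 0 \<and>
        (\<forall>p'. p' \<noteq> 0 \<and> poly (map_poly hom p') x = 0 \<longrightarrow> degree p \<le> degree p')"
    have nz: "p \<noteq> 0" "m \<noteq> 0" using p m(1) by auto
    have "m dvd p" using p dvd unfolding R_def by blast
    then obtain k where k: "p = m * k" ..
    have "degree p \<le> degree m" using p nz m(2) unfolding R_def by blast
    hence "degree k = 0" using k nz by (auto simp: degree_mult_eq)
    then obtain c where "k = [:c:]" by (rule degree_eq_zeroE)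
    moreover have "lead_coeff k = 1" using p m(1) k by (simp add: lead_coeff_mult)
    ultimately show "p = m" using k by simp
  qed
  thus ?thesis using dvd unfolding R_def by simp
qed

lemma poly_sum_lessThan:
  fixes p :: "'a::comm_semiring_1 poly"
  assumes "degree p < n"
  shows "poly p x = (\<Sum>m<n. coeff p m * x ^ m)"
proof -
  have "poly p x = (\<Sum>m\<le>degree p. coeff p m * x ^ m)" by (rule poly_altdef)
  also have "\<dots> = (\<Sum>m<n. coeff p m * x ^ m)"
    using assms by (intro sum.mono_neutral_left) (auto simp: coeff_eq_0)
  finally show ?thesis .
qed

subsection \<open>Cyclic codes and their duals\<close>

text \<open>The generator \<alpha> is replaced by its consequence that \<beta> has order exactly
  n.\<close>

locale bch_field = bch_params q s n + field_hom h
  for q s n :: nat and h :: "'a::field_gcd \<Rightarrow> 'b::field" +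
  fixes \<beta> :: 'b
  assumes primepow_q: "primepow q"
    and card_a: "card (UNIV :: 'a set) = q"
    and card_b: "card (UNIV :: 'b set) = q ^ (2 * s)"
    and \<beta>_n: "\<beta> ^ n = 1"
    and \<beta>_order: "\<And>j. \<beta> ^ j = 1 \<Longrightarrow> n dvd j"
begin

lemma finite_a: "finite (UNIV :: 'a set)"
  using card_a q_ge by (intro card_ge_0_finite) auto

lemma finite_b: "finite (UNIV :: 'b set)"
  using card_b q_ge by (intro card_ge_0_finite) auto

lemma power_q_a: "(x :: 'a) ^ q = x"
  using finite_field_power_card[OF finite_a] card_a by metis

lemma power_q_b: "(y :: 'b) ^ q ^ (2 * s) = y"
  using finite_field_power_card[OF finite_b] card_b by metis

lemma prime_CHAR_b: "prime CHAR('b)"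
  using finite_imp_CHAR_pos[OF finite_b] by (rule prime_CHAR_semidom)

text \<open>Makes y -> y^q a Frobenius power, hence additive.\<close>

lemma q_CHAR: "\<exists>e. q = CHAR('b) ^ e"
proof -
  obtain p e where p: "prime p" "q = p ^ e"
    using primepow_q unfolding primepow_def by auto
  have "CHAR('b) dvd q ^ (2 * s)" using CHAR_dvd_card_UNIV[OF finite_b] card_b by simp
  hence "CHAR('b) dvd p" using p prime_CHAR_b prime_dvd_power by blast
  hence "CHAR('b) = p" using p(1) prime_CHAR_b primes_dvd_imp_eq by blast
  thus ?thesis using p(2) by blast
qed

lemma power_q_sum: "(\<Sum>i\<in>A. f i :: 'b) ^ q ^ k = (\<Sum>i\<in>A. f i ^ q ^ k)"
proof -
  obtain e where "q = CHAR('b) ^ e" using q_CHAR by blast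
  thus ?thesis using freshmans_dream_sum'[OF prime_CHAR_b, of "q ^ k" "e * k" f A]
    by (simp add: power_mult)
qed

text \<open>n divides q^(2s) - 1 and is thus prime to the characteristic, so the transform below can
  be inverted.\<close>

lemma of_nat_n: "of_nat n \<noteq> (0 :: 'b)"
proof
  assume "of_nat n = (0 :: 'b)"
  hence "CHAR('b) dvd n" by (simp add: of_nat_eq_0_iff_char_dvd)
  hence "CHAR('b) dvd q ^ (2 * s) - 1" unfolding n_eq[symmetric] by simp
  moreover have "CHAR('b) dvd q ^ (2 * s)" using CHAR_dvd_card_UNIV[OF finite_b] card_b by simp
  ultimately have "CHAR('b) dvd q ^ (2 * s) - (q ^ (2 * s) - 1)" by (rule dvd_diff_nat[rotated])
  moreover have "1 \<le> q ^ (2 * s)" using q_ge by simp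
  ultimately have "CHAR('b) dvd 1" by simp
  thus False using prime_CHAR_b by simp
qed

text \<open>X^q - X has at most q roots, and the image of h already supplies q of them.\<close>

lemma fixed_imp_range: assumes "y ^ q = y" shows "y \<in> range h"
proof -
  define p :: "'b poly" where "p = monom 1 q - monom 1 1"
  have "coeff p q = 1" unfolding p_def using q_ge by simp
  hence p: "p \<noteq> 0" by auto
  have deg: "degree p \<le> q" unfolding p_def using q_ge
    by (intro degree_diff_le) (auto simp: degree_monom_eq)
  let ?S = "{y. poly p y = 0}"
  have S: "z \<in> ?S \<longleftrightarrow> z ^ q = z" for z by (simp add: p_def poly_monom)
  have "range h \<subseteq> ?S" using S power_q_a by (auto simp flip: hom_power)
  moreover have "card (range h) = q"
    using card_a by (simp add: card_image inj_f)
  moreover have "card ?S \<le> q" using card_poly_roots_bound[OF p] deg by simp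
  moreover have "finite ?S" using poly_roots_finite[OF p] .
  ultimately have "range h = ?S" by (intro card_subset_eq) (auto intro: card_mono antisym)
  thus ?thesis using S assms by blast
qed

section \<open>Powers of \<beta>, the discrete Fourier transform and codes given by zeros\<close>

lemma \<beta>_nz: "\<beta> \<noteq> 0" using \<beta>_n n_pos by (auto simp: power_0_left)

lemma \<beta>_powi_eq_1: "\<beta> powi i = 1 \<longleftrightarrow> int n dvd i"
proof -
  have nat: "\<beta> powi (int j) = 1 \<longleftrightarrow> n dvd j" for j
    using \<beta>_order \<beta>_n by (auto simp: power_mult elim!: dvdE)
  show ?thesis
  proof (cases i rule: int_cases2)
    case (nonneg j)
    thus ?thesis using nat by simp
  next
    case (nonpos j)
    thus ?thesis using nat[of j] by (simp add: power_int_minus)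
  qed
qed

lemma \<beta>_powi_add: "\<beta> powi (i + j) = \<beta> powi i * \<beta> powi j"
  using \<beta>_nz by (simp add: power_int_add)

lemma \<beta>_powi_cong:
  assumes "[i = j] (mod int n)" shows "\<beta> powi i = \<beta> powi j"
proof -
  have "\<beta> powi i = \<beta> powi (j + (i - j))" by simp
  also have "\<dots> = \<beta> powi j * \<beta> powi (i - j)" by (rule \<beta>_powi_add)
  also have "\<beta> powi (i - j) = 1" using assms \<beta>_powi_eq_1 cong_iff_dvd_diff by blast
  finally show ?thesis by simp
qed

lemma sum_\<beta>_powi: "(\<Sum>m<n. \<beta> powi (i * int m)) = (if int n dvd i then of_nat n else 0)"
proof -
  have eq: "(\<Sum>m<n. \<beta> powi (i * int m)) = (\<Sum>m<n. (\<beta> powi i) ^ m)"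
    by (simp add: power_int_mult)
  show ?thesis
  proof (cases "int n dvd i")
    case True
    hence "\<beta> powi i = 1" using \<beta>_powi_eq_1 by blast
    thus ?thesis using eq True by simp
  next
    case False
    hence ne: "\<beta> powi i \<noteq> 1" using \<beta>_powi_eq_1 by blast
    have "(\<beta> powi i) ^ n = \<beta> powi (i * int n)" by (simp add: power_int_mult)
    also have "\<dots> = 1" by (simp add: \<beta>_powi_eq_1)
    finally have "(\<Sum>m<n. (\<beta> powi i) ^ m) = 0" using ne by (simp add: geometric_sum)
    thus ?thesis using eq False by simp
  qed
qed

definition dft :: "'a vec \<Rightarrow> int \<Rightarrow> 'b" where
  "dft c i = (\<Sum>m<n. h (c $ m) * \<beta> powi (i * int m))"

definition root_code :: "nat set \<Rightarrow> 'a vec set" where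
  "root_code J = {c \<in> carrier_vec n. \<forall>j\<in>J. dft c (int j) = 0}"

lemma power_qk_a: "(x :: 'a) ^ q ^ k = x"
  by (induction k) (simp_all add: power_mult power_q_a)

text \<open>The entries of c are fixed by y -> y^q, so Frobenius acts on the index alone; zeros
  therefore come in whole cosets.\<close>

lemma dft_power: "dft c (i * int q ^ k) = dft c i ^ q ^ k"
proof -
  have "\<beta> powi (i * int q ^ k * int m) = (\<beta> powi (i * int m)) ^ q ^ k" for m
    by (simp add: power_int_power' mult_ac)
  moreover have "h (c $ m) ^ q ^ k = h (c $ m)" for m
    by (simp add: power_qk_a flip: hom_power)
  ultimately show ?thesis
    unfolding dft_def power_q_sum by (simp add: power_mult_distrib)
qed

lemma dft_cong: assumes "[i = j] (mod int n)" shows "dft c i = dft c j"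
  unfolding dft_def using assms by (intro sum.cong refl arg_cong2[of _ _ _ _ "(*)"] \<beta>_powi_cong cong_scalar_right) auto

lemma dft_sim: assumes "i \<sim> j" "dft c i = 0" shows "dft c j = 0"
proof -
  obtain k where "[j = i * int q ^ k] (mod int n)" using assms(1) unfolding coset_sim_def by blast
  hence "dft c j = dft c i ^ q ^ k" using dft_cong dft_power by metis
  thus ?thesis using assms(2) q_ge by simp
qed

lemma dft_in_cosets: "c \<in> root_code J \<Longrightarrow> in_cosets q n J i \<Longrightarrow> dft c i = 0"
  unfolding root_code_def in_cosets_def using dft_sim by blast

lemma dft_coeff:
  assumes "degree p < n"
  shows "dft (vec n (coeff p)) (int j) = poly (map_poly h p) (\<beta> ^ j)"
proof -
  have "degree (map_poly h p) < n" using assms by simp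
  hence "poly (map_poly h p) (\<beta> ^ j) = (\<Sum>m<n. h (coeff p m) * (\<beta> ^ j) ^ m)"
    by (subst poly_sum_lessThan) auto
  also have "\<dots> = dft (vec n (coeff p)) (int j)"
    unfolding dft_def by (intro sum.cong) (auto simp: power_mult simp flip: of_nat_mult)
  finally show ?thesis ..
qed

text \<open>The generator divides p exactly when p vanishes at all \<beta>^j. It divides x^n - 1, so
  reduction preserves this; conversely a polynomial of degree below n is its own remainder.\<close>

lemma cyclic_code_Lcm_min_poly:
  assumes "finite J"
  shows "cyclic_code n (Lcm ((\<lambda>j. min_poly h (\<beta> ^ j)) ` J)) = root_code J" (is "cyclic_code n ?g = _")
proof -
  define X :: "'a poly" where "X = monom 1 n - 1"
  have X0: "coeff X n = 1" unfolding X_def using n_pos by simp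
  hence X: "X \<noteq> 0" by auto
  have "degree X \<le> n" unfolding X_def by (intro degree_diff_le) (auto simp: degree_monom_le)
  hence degX: "degree X = n" using X0 le_degree[of X n] by simp
  have rootX: "poly (map_poly h X) (\<beta> ^ j) = 0" for j
  proof -
    interpret map_poly_hom: map_poly_idom_hom h ..
    have "map_poly h X = monom 1 n - 1" unfolding X_def by (simp add: map_poly_hom.hom_minus)
    moreover have "(\<beta> ^ j) ^ n = 1" using \<beta>_n by (metis mult.commute power_mult power_one)
    ultimately show ?thesis by (simp add: poly_monom)
  qed
  note mp = min_poly_dvd_iff[OF X rootX]
  have g_dvd: "?g dvd p \<longleftrightarrow> (\<forall>j\<in>J. poly (map_poly h p) (\<beta> ^ j) = 0)" for p
    unfolding Lcm_dvd_iff using mp by auto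
  have gX: "?g dvd X" using g_dvd rootX by blast
  show ?thesis
  proof (intro subset_antisym subsetI)
    fix c assume "c \<in> cyclic_code n ?g"
    then obtain f where c: "c = vec n (coeff ((f * ?g) mod X))"
      unfolding cyclic_code_def X_def by auto
    let ?r = "(f * ?g) mod X"
    have "degree ?r < n" using degree_mod_less[OF X, of "f * ?g"] degX n_pos by auto
    moreover have "?g dvd ?r" using gX by (simp add: dvd_mod)
    ultimately show "c \<in> root_code J"
      unfolding root_code_def c using g_dvd[of ?r] by (simp add: dft_coeff)
  next
    fix c assume "c \<in> root_code J"
    hence c: "c \<in> carrier_vec n" "\<And>j. j \<in> J \<Longrightarrow> dft c (int j) = 0"
      unfolding root_code_def by auto
    define r where "r = (\<Sum>m<n. monom (c $ m) m)"
    have r: "coeff r m = (if m < n then c $ m else 0)" for m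
      unfolding r_def by (simp add: coeff_sum sum.delta')
    have deg: "degree r < n" using n_pos r by (intro degree_lessI) auto
    have cr: "c = vec n (coeff r)" using c(1) r by (intro eq_vecI) auto
    have "?g dvd r" unfolding g_dvd using c(2) dft_coeff[OF deg] cr by metis
    then obtain f where f: "r = f * ?g" by (metis dvdE mult.commute)
    have "r mod X = r" using deg degX by (intro mod_poly_less) simp
    hence "c = vec n (coeff ((f * ?g) mod X))" using cr f by simp
    thus "c \<in> cyclic_code n ?g" unfolding cyclic_code_def X_def[symmetric] by blast
  qed
qed

lemma bch_code_eq: "bch_code h \<beta> n \<delta> b = root_code {b..b + \<delta> - 2}"
  unfolding bch_code_def by (rule cyclic_code_Lcm_min_poly) simp

section \<open>Codewords from the trace\<close>

definition tr :: "'b \<Rightarrow> 'b" where "tr y = (\<Sum>k<2 * s. y ^ q ^ k)"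

lemma tr_range: "tr y \<in> range h"
proof (rule fixed_imp_range)
  have "tr y ^ q = (\<Sum>k<2 * s. y ^ q ^ Suc k)"
    using power_q_sum[of "\<lambda>k. y ^ q ^ k" "{..<2 * s}" 1] unfolding tr_def
    by (simp add: mult.commute flip: power_mult)
  also have "\<dots> = (\<Sum>k<2 * s. y ^ q ^ k)"
    using sum.lessThan_Suc_shift[of "\<lambda>k. y ^ q ^ k" "2 * s"] power_q_b[of y] by simp
  finally show "tr y ^ q = tr y" unfolding tr_def .
qed

text \<open>A polynomial of degree below the field size that vanishes everywhere is zero, and a 0 is
  its coefficient at x. This plays the part of the nondegeneracy of the trace.\<close>

lemma linearized_zero:
  fixes a :: "nat \<Rightarrow> 'b"
  assumes "\<And>u. (\<Sum>k<2 * s. a k * u ^ q ^ k) = 0"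
  shows "a 0 = 0"
proof -
  define p where "p = (\<Sum>k<2 * s. monom (a k) (q ^ k))"
  have "degree p \<le> q ^ (2 * s - 1)" unfolding p_def
  proof (rule degree_sum_le)
    fix k assume k: "k \<in> {..<2 * s}"
    have "degree (monom (a k) (q ^ k)) \<le> q ^ k" by (rule degree_monom_le)
    also have "\<dots> \<le> q ^ (2 * s - 1)" using k q_ge by (intro power_increasing) auto
    finally show "degree (monom (a k) (q ^ k)) \<le> q ^ (2 * s - 1)" .
  qed simp
  also have "\<dots> < q ^ (2 * s)" using q_ge s_ge by (intro power_strict_increasing) auto
  finally have "degree p < card {x. poly p x = 0}"
    using assms by (simp add: p_def poly_sum poly_monom card_b)
  hence "p = 0" using card_poly_roots_bound[of p] by fastforce
  moreover have "coeff p 1 = a 0"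
  proof -
    have "q ^ k = 1 \<longleftrightarrow> k = 0" for k using q_ge by (cases k) auto
    thus ?thesis unfolding p_def using s_ge by (simp add: coeff_sum sum.delta)
  qed
  ultimately show ?thesis by simp
qed

definition trace_word :: "'b \<Rightarrow> int \<Rightarrow> 'a vec" where
  "trace_word u i = vec n (\<lambda>m. inv_into UNIV h (tr (u * \<beta> powi (i * int m))))"

lemma h_trace_word: "m < n \<Longrightarrow> h (trace_word u i $ m) = tr (u * \<beta> powi (i * int m))"
  unfolding trace_word_def using f_inv_into_f[OF tr_range] by simp

text \<open>Exhibits the sum as a linearized polynomial in u, the form that
  \<open>linearized_zero\<close> needs.\<close>

lemma sum_tr: "(\<Sum>m<n. b m * tr (u * \<beta> powi (i * int m)))
  = (\<Sum>k<2 * s. (\<Sum>m<n. b m * \<beta> powi (i * int q ^ k * int m)) * u ^ q ^ k)"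
proof -
  have "(u * \<beta> powi (i * int m)) ^ q ^ k = u ^ q ^ k * \<beta> powi (i * int q ^ k * int m)" for m k
    by (simp add: power_mult_distrib power_int_power' mult_ac)
  thus ?thesis unfolding tr_def sum_distrib_left sum_distrib_right
    by (subst sum.swap) (simp add: mult_ac)
qed

lemma dft_trace_word: "dft (trace_word u i) j
  = (\<Sum>k<2 * s. (if int n dvd i * int q ^ k + j then of_nat n else 0) * u ^ q ^ k)"
proof -
  have "dft (trace_word u i) j = (\<Sum>m<n. \<beta> powi (j * int m) * tr (u * \<beta> powi (i * int m)))"
    unfolding dft_def by (intro sum.cong) (simp_all add: h_trace_word mult.commute)
  also have "\<dots> = (\<Sum>k<2 * s. (\<Sum>m<n. \<beta> powi ((i * int q ^ k + j) * int m)) * u ^ q ^ k)"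
  proof -
    have "\<beta> powi (j * int m) * \<beta> powi (i * int q ^ k * int m)
      = \<beta> powi ((i * int q ^ k + j) * int m)" for k m
      using \<beta>_powi_add[of "j * int m" "i * int q ^ k * int m"] by (simp add: algebra_simps)
    thus ?thesis unfolding sum_tr by simp
  qed
  finally show ?thesis unfolding sum_\<beta>_powi .
qed

lemma trace_word_in_root_code:
  assumes "\<not> in_cosets q n J (- i)"
  shows "trace_word u i \<in> root_code J"
proof -
  have "dft (trace_word u i) (int j) = 0" if "j \<in> J" for j
  proof -
    have "\<not> int n dvd i * int q ^ k + int j" for k
    proof
      assume "int n dvd i * int q ^ k + int j"
      hence "[int j = (- i) * int q ^ k] (mod int n)"
        by (simp add: cong_iff_dvd_diff algebra_simps)
      hence "int j \<sim> - i" by (rule sim_sym[OF coset_sim_powerI])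
      thus False using assms that unfolding in_cosets_def by blast
    qed
    thus ?thesis unfolding dft_trace_word by simp
  qed
  thus ?thesis unfolding root_code_def trace_word_def by auto
qed

text \<open>If i were not covered by J1, all trace words with index -i would lie in both codes.
  Their transform at i is a linearized polynomial in u whose first coefficient is n, and it would
  vanish for every u.\<close>

lemma root_code_subset:
  assumes "root_code J1 \<subseteq> root_code J2" "in_cosets q n J2 i"
  shows "in_cosets q n J1 i"
proof (rule ccontr)
  assume "\<not> in_cosets q n J1 i"
  hence "trace_word u (- i) \<in> root_code J2" for u
    using assms(1) trace_word_in_root_code[of J1 "- i"] by auto
  hence "dft (trace_word u (- i)) i = 0" for u using dft_in_cosets assms(2) by blast
  hence "(if int n dvd (- i) * int q ^ 0 + i then of_nat n else 0) = (0 :: 'b)"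
    unfolding dft_trace_word
    by (rule linearized_zero[where a = "\<lambda>k. if int n dvd (- i) * int q ^ k + i then of_nat n else 0"])
  thus False using of_nat_n by simp
qed

section \<open>Duality of codes given by zeros\<close>

lemma h_scalar_prod:
  assumes "x \<in> carrier_vec n" "c \<in> carrier_vec n"
  shows "h (x \<bullet> c) = (\<Sum>m<n. h (x $ m) * h (c $ m))"
  using assms unfolding scalar_prod_def by (simp add: hom_distribs lessThan_atLeast0)

lemma parseval:
  assumes "x \<in> carrier_vec n" "c \<in> carrier_vec n"
  shows "of_nat n * h (x \<bullet> c) = (\<Sum>j<n. dft x (int j) * dft c (- int j))"
proof -
  have "(\<Sum>j<n. dft x (int j) * dft c (- int j))
    = (\<Sum>j<n. \<Sum>k<n. \<Sum>m<n. h (x $ k) * h (c $ m) * \<beta> powi ((int k - int m) * int j))"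
    unfolding dft_def sum_product
    by (intro sum.cong refl) (simp add: algebra_simps flip: \<beta>_powi_add)
  also have "\<dots> = (\<Sum>k<n. \<Sum>j<n. \<Sum>m<n. h (x $ k) * h (c $ m) * \<beta> powi ((int k - int m) * int j))"
    by (rule sum.swap)
  also have "\<dots> = (\<Sum>k<n. \<Sum>m<n. h (x $ k) * h (c $ m) * (\<Sum>j<n. \<beta> powi ((int k - int m) * int j)))"
    unfolding sum_distrib_left by (intro sum.cong refl sum.swap)
  also have "\<dots> = (\<Sum>k<n. \<Sum>m<n. if m = k then h (x $ k) * h (c $ m) * of_nat n else 0)"
  proof (intro sum.cong refl)
    fix k m assume "k \<in> {..<n}" "m \<in> {..<n}"
    hence "int n dvd int k - int m \<longleftrightarrow> m = k"
      using cong_imp_eq_of_abs_diff_less[of "int k" "int m"] by (auto simp: cong_iff_dvd_diff)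
    thus "h (x $ k) * h (c $ m) * (\<Sum>j<n. \<beta> powi ((int k - int m) * int j))
      = (if m = k then h (x $ k) * h (c $ m) * of_nat n else 0)"
      unfolding sum_\<beta>_powi by simp
  qed
  also have "\<dots> = of_nat n * h (x \<bullet> c)"
    using h_scalar_prod[OF assms] by (simp add: sum.delta sum_distrib_left mult_ac)
  finally show ?thesis ..
qed

text \<open>In Parseval's sum each product has a vanishing factor, since either -j is covered by J
  or j by K. Conversely, orthogonality to all trace words with index j in K forces the transform to
  vanish at j.\<close>

lemma dual_root_code:
  assumes K: "\<And>i. in_cosets q n K i \<longleftrightarrow> \<not> in_cosets q n J (- i)"
  shows "dual_code n (root_code J) = root_code K"
proof (intro subset_antisym subsetI)
  fix x assume x_K: "x \<in> root_code K"
  hence x: "x \<in> carrier_vec n" unfolding root_code_def by simp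
  have "x \<bullet> c = 0" if c: "c \<in> root_code J" for c
  proof -
    have "dft x (int j) * dft c (- int j) = 0" for j
    proof (cases "in_cosets q n J (- int j)")
      case True
      thus ?thesis using dft_in_cosets[OF c] by simp
    next
      case False
      thus ?thesis using dft_in_cosets[OF x_K] K by simp
    qed
    hence "(\<Sum>j<n. dft x (int j) * dft c (- int j)) = 0" by (rule sum.neutral[rule_format])
    hence "of_nat n * h (x \<bullet> c) = 0"
      using parseval[of x c] x c unfolding root_code_def by simp
    thus ?thesis using of_nat_n by simp
  qed
  thus "x \<in> dual_code n (root_code J)" using x unfolding dual_code_def by blast
next
  fix x assume x: "x \<in> dual_code n (root_code J)"
  have "dft x (int j) = 0" if j: "j \<in> K" for j
  proof -
    have "in_cosets q n K (int j)" using j coset_sim_refl unfolding in_cosets_def by blast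
    hence "trace_word u (int j) \<in> root_code J" for u
      using K trace_word_in_root_code by blast
    hence "h (x \<bullet> trace_word u (int j)) = 0" for u using x unfolding dual_code_def by simp
    hence "(\<Sum>m<n. h (x $ m) * tr (u * \<beta> powi (int j * int m))) = 0" for u
      using h_scalar_prod[of x "trace_word u (int j)"] x h_trace_word
      unfolding dual_code_def by (simp add: trace_word_def)
    hence "(\<Sum>m<n. h (x $ m) * \<beta> powi (int j * int q ^ 0 * int m)) = 0"
      unfolding sum_tr
      by (rule linearized_zero[where a = "\<lambda>k. \<Sum>m<n. h (x $ m) * \<beta> powi (int j * int q ^ k * int m)"])
    thus ?thesis unfolding dft_def by simp
  qed
  thus "x \<in> root_code K" using x unfolding dual_code_def root_code_def by blast
qed

lemma dual_root_code_iff: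
  "dual_code n (root_code J) = root_code K
    \<longleftrightarrow> (\<forall>i. in_cosets q n K i \<longleftrightarrow> \<not> in_cosets q n J (- i))"
proof
  assume eq: "dual_code n (root_code J) = root_code K"
  \<comment> \<open>The full set of dual zeros always describes the dual, so K and K' define the
    same code and hence cover the same cosets.\<close>
  define K' where "K' = {j. \<not> in_cosets q n J (- int j)}"
  have K': "in_cosets q n K' i \<longleftrightarrow> \<not> in_cosets q n J (- i)" for i
  proof
    assume "in_cosets q n K' i"
    then obtain j where "j \<in> K'" and ji: "int j \<sim> i" unfolding in_cosets_def by blast
    hence j: "\<not> in_cosets q n J (- int j)" unfolding K'_def by simp
    have "- i \<sim> - int j" by (rule coset_sim_uminus[OF sim_sym[OF ji]])
    thus "\<not> in_cosets q n J (- i)" using j in_cosets_sim by blast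
  next
    assume i: "\<not> in_cosets q n J (- i)"
    define j where "j = nat (i mod int n)"
    have "[int j = i] (mod int n)" unfolding j_def using n_pos by (simp add: cong_def)
    hence ji: "int j \<sim> i" using coset_sim_cong[OF _ cong_refl] coset_sim_refl by blast
    hence "- int j \<sim> - i" by (rule coset_sim_uminus)
    hence "j \<in> K'" using i in_cosets_sim unfolding K'_def by blast
    thus "in_cosets q n K' i" using ji unfolding in_cosets_def by blast
  qed
  hence "root_code K' = root_code K" using dual_root_code[of K' J] eq by simp
  hence "in_cosets q n K i \<longleftrightarrow> in_cosets q n K' i" for i
    using root_code_subset by blast
  thus "\<forall>i. in_cosets q n K i \<longleftrightarrow> \<not> in_cosets q n J (- i)" using K' by blast
qed (simp add: dual_root_code)

end

subsection \<open>Dually-BCH codes\<close>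

theorem theorem28:
  fixes h :: "'a::field_gcd \<Rightarrow> 'b::field"
    and \<alpha> \<beta>\<^sub>1 :: 'b
    and q s n \<delta> \<delta>\<^sub>1 :: nat
  assumes "primepow q" and "q \<ge> 3" and "s \<ge> 2"
    and "n = (q ^ (2 * s) - 1) div (q + 1)"
    and "2 \<le> \<delta>" and "\<delta> \<le> n"
    and "card (UNIV :: 'a set) = q" and "card (UNIV :: 'b set) = q ^ (2 * s)"
    and "field_hom h"
    and "range (\<lambda>k. \<alpha> ^ k) = UNIV - {0}"
    and "\<beta>\<^sub>1 = \<alpha> ^ (q + 1)"
    and "\<delta>\<^sub>1 = largest_coset_leader q n"
  shows "(s = 2 \<longrightarrow>
            (dually_bch h \<beta>\<^sub>1 n (bch_code h \<beta>\<^sub>1 n \<delta> 2) \<longleftrightarrow> \<delta>\<^sub>1 - 1 \<le> \<delta> \<and> \<delta> \<le> n - 1)) \<and>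
         (s \<noteq> 2 \<longrightarrow>
            (dually_bch h \<beta>\<^sub>1 n (bch_code h \<beta>\<^sub>1 n \<delta> 2) \<longleftrightarrow> \<delta>\<^sub>1 \<le> \<delta> \<and> \<delta> \<le> n - 1))"
proof -
  have "(q + 1) dvd q ^ (2 * s) - 1"
  proof -
    have "int q ^ (2 * s) - 1 = (int q ^ 2 - 1) * (\<Sum>i<s. (int q ^ 2) ^ i)"
      by (metis power_diff_1_eq power_mult)
    also have "\<dots> = (int q + 1) * ((int q - 1) * (\<Sum>i<s. (int q ^ 2) ^ i))"
      by (simp add: algebra_simps power2_eq_square)
    finally have "int q + 1 dvd int q ^ (2 * s) - 1" by simp
    moreover have "int (q ^ (2 * s) - 1) = int q ^ (2 * s) - 1"
      using assms(2) by (simp add: of_nat_diff)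
    ultimately have "int (q + 1) dvd int (q ^ (2 * s) - 1)" by (simp add: add.commute)
    thus ?thesis by (simp only: int_dvd_int_iff)
  qed
  hence n: "(q + 1) * n = q ^ (2 * s) - 1"
    unfolding assms(4) by (rule dvd_mult_div_cancel)
  interpret P: bch_params q s n by unfold_locales (use assms n in auto)
  interpret h: field_hom h by (rule assms(9))
  have fin: "finite (UNIV :: 'b set)"
    using assms(2,8) by (intro card_ge_0_finite) auto
  have \<alpha>_nz: "\<alpha> \<noteq> 0"
  proof -
    have "\<alpha> ^ 1 \<in> UNIV - {0}" unfolding assms(10)[symmetric] by (rule rangeI)
    thus ?thesis by simp
  qed
  have \<alpha>_power: "\<alpha> ^ (q ^ (2 * s) - 1) = 1"
  proof -
    have "q ^ (2 * s) = Suc (q ^ (2 * s) - 1)" using assms(2) by simp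
    hence "\<alpha> * \<alpha> ^ (q ^ (2 * s) - 1) = \<alpha>"
      using finite_field_power_card[OF fin, of \<alpha>] assms(8) by (metis power_Suc)
    thus ?thesis using \<alpha>_nz by simp
  qed
  \<comment> \<open>If \<alpha>^k = 1, the powers of \<alpha> take at most k values, yet they
    exhaust the nonzero elements.\<close>
  have \<alpha>_order: "q ^ (2 * s) - 1 \<le> k" if "\<alpha> ^ k = 1" "0 < k" for k
  proof -
    have "\<alpha> ^ i = \<alpha> ^ (i mod k)" for i
    proof -
      have "\<alpha> ^ i = (\<alpha> ^ k) ^ (i div k) * \<alpha> ^ (i mod k)"
        by (simp flip: power_mult power_add)
      thus ?thesis using that(1) by simp
    qed
    hence "range (\<lambda>i. \<alpha> ^ i) \<subseteq> (\<lambda>i. \<alpha> ^ i) ` {..<k}"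
      using that(2) by (metis (mono_tags, lifting) image_subsetI imageI lessThan_iff mod_less_divisor)
    hence "card (range (\<lambda>i. \<alpha> ^ i)) \<le> card {..<k}" by (rule surj_card_le[rotated]) simp
    thus ?thesis unfolding assms(10) using fin assms(8) by simp
  qed
  have \<beta>_n: "\<beta>\<^sub>1 ^ n = 1" using \<alpha>_power n assms(11) by (metis power_mult)
  \<comment> \<open>A nonzero remainder of j modulo n would give \<alpha> a positive exponent (q +
    1)(j mod n) below its order.\<close>
  have \<beta>_order: "n dvd j" if "\<beta>\<^sub>1 ^ j = 1" for j
  proof (rule ccontr)
    assume "\<not> n dvd j"
    hence r: "0 < j mod n" "j mod n < n" using P.n_pos by (auto simp: dvd_eq_mod_eq_0)
    have "\<beta>\<^sub>1 ^ j = (\<beta>\<^sub>1 ^ n) ^ (j div n) * \<beta>\<^sub>1 ^ (j mod n)"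
      by (simp flip: power_mult power_add)
    hence "\<alpha> ^ ((q + 1) * (j mod n)) = 1"
      using that \<beta>_n assms(11) by (simp only: power_mult) simp
    hence "(q + 1) * n \<le> (q + 1) * (j mod n)"
      unfolding n using r by (intro \<alpha>_order) auto
    hence "n \<le> j mod n" by (rule mult_left_le_imp_le) simp
    thus False using r(2) by simp
  qed
  interpret bch_field q s n h \<beta>\<^sub>1
    by unfold_locales (use assms \<beta>_n \<beta>_order in auto)
  have "dually_bch h \<beta>\<^sub>1 n (bch_code h \<beta>\<^sub>1 n \<delta> 2) \<longleftrightarrow> P.dual_interval \<delta>"
  proof -
    have "is_bch_code h \<beta>\<^sub>1 n (bch_code h \<beta>\<^sub>1 n \<delta> 2)"
      unfolding is_bch_code_def using assms(5,6)
      by (intro exI[of _ 2] exI[of _ \<delta>]) simp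
    moreover have "bch_code h \<beta>\<^sub>1 n \<delta> 2 = root_code {2..\<delta>}"
      using bch_code_eq[of \<delta> 2] by simp
    ultimately show ?thesis
      unfolding dually_bch_def is_bch_code_def[of _ _ _ "dual_code n _"] P.dual_interval_def
        bch_code_eq dual_root_code_iff[symmetric] by simp
  qed
  thus ?thesis using P.dual_interval_iff[OF assms(5,6)] assms(12) by simp
qed

end
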